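(* Let $1<p<2$ and $n\in\mathbb{N}$. Suppose that $f\in H^p$ has inner part $J$, with $J(0)\ne0$. Let $w_1,\dots,w_k$ be the roots (counting multiplicities) of $q_{n,p}[f]$ in $\mathbb{D}$. Then $$|w_1\cdots w_k|\ge\frac{\left(1-\left[1-\frac{|f(0)|^2}{\|f\|_2^2}\right]^{p/2}\right)^{1/2}}{|J(0)|}.$$ In particular, if $f=J$ is inner, then $$|w_1\cdots w_k|\ge\frac{\left(1-\left[1-|J(0)|^2\right]^{p/2}\right)^{1/2}}{|J(0)|}.$$
   Context: $\mathbb{N}=\{0,1,2,\dots\}$ and $\mathbb{D}$ is the open unit disk. $H^p$ is the Hardy space of analytic functions on $\mathbb{D}$ with norm $\|f\|_p^p=\sup_{0<r<1}\frac1{2\pi}\int_0^{2\pi}|f(re^{i\theta})|^p\,d\theta$; $\|f\|_2$ is the corresponding quantity for exponent $2$, and if $f\notin H^2$ (so $\|f\|_2=\infty$) the quotient $|f(0)|^2/\|f\|_2^2$ is read as $0$. Every nonzero $f\in H^p$ factors as $f=JF$ with $J$ inner (bounded analytic with boundary values of modulus $1$ a.e.) and $F$ outer; $J$ is its inner part, unique up to a unimodular constant. $\mathcal{P}_n$ is the set of complex polynomials of degree at most $n$. For $f\in H^p$ with $f(0)\ne0$, the $n$-th optimal polynomial approximant $q_{n,p}[f]$ to $1/f$ in $H^p$ is the unique element of $\mathcal{P}_n$ with $\|1-q_{n,p}[f]f\|_p=\inf_{q\in\mathcal{P}_n}\|1-qf\|_p$. An empty product (no roots in $\mathbb{D}$)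 equals $1$. *)

theory Defs
  imports "HOL-Complex_Analysis.Complex_Analysis"
begin

definition hardy_mean :: "real \<Rightarrow> (complex \<Rightarrow> complex) \<Rightarrow> real \<Rightarrow> real" where
  "hardy_mean p f r =
     1 / (2 * pi) * integral {0..2 * pi} (\<lambda>t. norm (f (of_real r * cis t)) powr p)"

definition hardy_space :: "real \<Rightarrow> (complex \<Rightarrow> complex) set" where
  "hardy_space p =
     {f. f holomorphic_on ball 0 1 \<and> bdd_above (hardy_mean p f ` {0<..<1})}"

(* Real-valued, hence meaningful only for members of the Hardy space. *)
definition hardy_norm :: "real \<Rightarrow> (complex \<Rightarrow> complex) \<Rightarrow> real" where
  "hardy_norm p f = (SUP r\<in>{0<..<1}. hardy_mean p f r) powr (1 / p)"

(* |f(0)|^2 / ||f||_2^2, read as 0 when ||f||_2 is infinite. *)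
definition hardy2_quotient :: "(complex \<Rightarrow> complex) \<Rightarrow> real" where
  "hardy2_quotient f =
     (if f \<in> hardy_space 2 then (norm (f 0))\<^sup>2 / (hardy_norm 2 f)\<^sup>2 else 0)"

(* Boundary values are radial limits. *)
definition inner_function :: "(complex \<Rightarrow> complex) \<Rightarrow> bool" where
  "inner_function J \<longleftrightarrow>
     J holomorphic_on ball 0 1 \<and> bounded (J ` ball 0 1) \<and>
     (AE t in lebesgue_on {0..2 * pi}.
        \<exists>l. ((\<lambda>r. J (of_real r * cis t)) \<longlongrightarrow> l) (at_left 1) \<and> norm l = 1)"

(* h is the logarithm of the boundary modulus psi of F: writing h instead of ln psi avoids
   the convention ln 0 = 0. *)
definition outer_function :: "(complex \<Rightarrow> complex) \<Rightarrow> bool" where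
  "outer_function F \<longleftrightarrow>
     (\<exists>c h. norm c = 1 \<and> (h :: real \<Rightarrow> real) absolutely_integrable_on {0..2 * pi} \<and>
        (\<forall>z\<in>ball 0 1. F z =
           c * exp (1 / (2 * of_real pi) *
             integral {0..2 * pi} (\<lambda>t. (cis t + z) / (cis t - z) * of_real (h t)))))"

definition inner_part :: "(complex \<Rightarrow> complex) \<Rightarrow> (complex \<Rightarrow> complex) \<Rightarrow> bool" where
  "inner_part f J \<longleftrightarrow>
     inner_function J \<and>
     (\<exists>F. outer_function F \<and> (\<forall>z\<in>ball 0 1. f z = J z * F z))"

(* q = q_{n,p}[f], as a relation: q is a minimizer. Uniqueness of the minimizer is not built in. *)
definition optimal_poly_approx ::
    "nat \<Rightarrow> real \<Rightarrow> (complex \<Rightarrow> complex) \<Rightarrow> complex poly \<Rightarrow> bool" where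
  "optimal_poly_approx n p f q \<longleftrightarrow>
     degree q \<le> n \<and>
     hardy_norm p (\<lambda>z. 1 - poly q z * f z) =
       (INF s\<in>{s :: complex poly. degree s \<le> n}. hardy_norm p (\<lambda>z. 1 - poly s z * f z))"

definition roots_in_disk :: "complex poly \<Rightarrow> complex multiset" where
  "roots_in_disk q = filter_mset (\<lambda>w. w \<in> ball 0 1) (proots q)"

end

theory Submission
  imports Defs "HOL-Computational_Algebra.Fundamental_Theorem_Algebra"
begin

text \<open>
  Let \<open>q\<close> be the optimal approximant of \<open>f = J F\<close>, and let \<open>B\<close> be the Blaschke product of the roots
  \<open>w\<^sub>1, \<dots>, w\<^sub>k\<close> of \<open>q\<close> in the disk. Then \<open>q f = I s F\<close> with the inner function \<open>I = J B\<close> and a polynomial \<open>s\<close>,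
  and \<open>\<bar>I(0)\<bar> = \<bar>J(0) w\<^sub>1 \<cdots> w\<^sub>k\<bar>\<close>. The theorem follows from the two-sided estimate
  \<open>1 - \<bar>I(0)\<bar>\<^sup>2 \<le> \<parallel>1 - q f\<parallel>\<^sub>p\<^sup>p \<le> (1 - \<bar>f(0)\<bar>\<^sup>2 / \<parallel>f\<parallel>\<^sub>2\<^sup>2)\<^sup>p\<^sup>/\<^sup>2\<close>.

  The upper estimate (\<open>hardy_mean_constant_approximant\<close>) compares \<open>q\<close> with the constant that is optimal in
  quadratic mean, and uses that the \<open>p\<close>-norm is at most the 2-norm for \<open>p < 2\<close>.

  The lower estimate (\<open>inner_outer_lower_bound\<close>) is a bound for the distance from 1 to the multiples of an
  inner function. If \<open>I\<close> is a Moebius transformation of the disk, a function \<open>1 - I H\<close> takes the value 1 at the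
  zero of \<open>I\<close>, and that zero has modulus \<open>\<bar>I(0)\<bar>\<close>, so this is the growth estimate for point evaluation on
  the Hardy space. In general, put \<open>a = I(0)\<close>, \<open>u = 1 - cnj a * I\<close> and \<open>v = u powr (1 - 2 / p)\<close>, and test
  \<open>1 - I H\<close> against \<open>v cnj u\<close> on the unit circle. This test function plays the role of the point evaluation: \<open>v\<close> is
  1 modulo \<open>I\<close>, and \<open>cnj u\<close> is orthogonal to the multiples of \<open>I\<close>, so the integral is \<open>1 - \<bar>a\<bar>\<^sup>2\<close>. Young's
  inequality bounds the same integral by \<open>\<parallel>1 - I H\<parallel>\<^sub>p\<^sup>p / p + (1 - \<bar>a\<bar>\<^sup>2) (1 - 1 / p)\<close>, which gives the claim.

  All integrals are taken over circles of radius \<open>r < 1\<close>, where every function is continuous. Boundary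
  values are used only in the form that the means of \<open>1 - \<bar>I\<bar>\<^sup>2\<close> tend to 0 as \<open>r\<close> tends to 1
  (\<open>inner_mean_tendsto\<close>). For this defect to be harmless the cofactor of \<open>I\<close> must be bounded, which is arranged by
  truncating the boundary modulus of the outer function; the truncated exponents are controlled by the
  positivity of the Poisson kernel.
\<close>

section \<open>Means over circles\<close>

definition circle_mean :: "real \<Rightarrow> (complex \<Rightarrow> 'a::euclidean_space) \<Rightarrow> 'a" where
  "circle_mean r \<phi> = (1 / (2 * pi)) *\<^sub>R integral {0..2 * pi} (\<lambda>t. \<phi> (of_real r * cis t))"

lemma hardy_mean_eq_circle_mean:
  "hardy_mean p f r = circle_mean r (\<lambda>z. norm (f z) powr p)"
  by (simp add: hardy_mean_def circle_mean_def)

lemma continuous_on_norm_powr: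
  assumes "continuous_on S f" "0 < p"
  shows "continuous_on S (\<lambda>z. norm (f z) powr p)"
  by (rule continuous_on_powr'[OF continuous_on_norm[OF assms(1)] continuous_on_const])
     (use assms in auto)

context
  fixes r :: real
  assumes r: "0 < r" "r < 1"
begin

lemma on_circle: "of_real r * cis t \<in> ball (0::complex) 1"
  using r by (simp add: norm_mult)

lemma integrable_on_circle:
  fixes \<phi> :: "complex \<Rightarrow> 'a::euclidean_space"
  assumes "continuous_on (ball 0 1) \<phi>"
  shows "(\<lambda>t. \<phi> (of_real r * cis t)) integrable_on {0..2 * pi}"
  by (intro integrable_continuous_interval continuous_on_compose2[OF assms] continuous_intros)
     (use on_circle in auto)

lemma circle_mean_const [simp]: "circle_mean r (\<lambda>z. c) = c"
  by (simp add: circle_mean_def)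

lemma circle_mean_add:
  assumes "continuous_on (ball 0 1) \<phi>" "continuous_on (ball 0 1) \<psi>"
  shows "circle_mean r (\<lambda>z. \<phi> z + \<psi> z) = circle_mean r \<phi> + circle_mean r \<psi>"
  unfolding circle_mean_def
  by (subst integral_add) (use assms integrable_on_circle in \<open>auto simp: scaleR_add_right\<close>)

lemma circle_mean_diff:
  assumes "continuous_on (ball 0 1) \<phi>" "continuous_on (ball 0 1) \<psi>"
  shows "circle_mean r (\<lambda>z. \<phi> z - \<psi> z) = circle_mean r \<phi> - circle_mean r \<psi>"
  unfolding circle_mean_def
  by (subst integral_diff) (use assms integrable_on_circle in \<open>auto simp: scaleR_diff_right\<close>)

lemma circle_mean_mult:
  fixes c :: "'a::{euclidean_space, real_normed_field}"
  shows "circle_mean r (\<lambda>z. c * \<phi> z) = c * circle_mean r \<phi>"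
    and "circle_mean r (\<lambda>z. \<phi> z * c) = circle_mean r \<phi> * c"
  by (simp_all add: circle_mean_def)

lemma circle_mean_linear:
  assumes "continuous_on (ball 0 1) \<phi>" "bounded_linear L"
  shows "circle_mean r (\<lambda>z. L (\<phi> z)) = L (circle_mean r \<phi>)"
  using integral_linear[OF integrable_on_circle[OF assms(1)] assms(2)]
  by (simp add: circle_mean_def o_def linear_simps[OF assms(2)])

lemma circle_mean_cong:
  assumes "\<And>z. z \<in> ball 0 1 \<Longrightarrow> \<phi> z = \<psi> z"
  shows "circle_mean r \<phi> = circle_mean r \<psi>"
  using assms[OF on_circle] by (simp add: circle_mean_def)

text \<open>Continuity is required on the circle only, so that integrands with a pole inside it, such as the
  Cauchy kernel, are covered.\<close>
lemma norm_circle_mean_le_sphere: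
  fixes \<phi> :: "complex \<Rightarrow> 'a::euclidean_space"
  assumes "continuous_on (sphere 0 r) \<phi>" "continuous_on (sphere 0 r) \<psi>"
    and le: "\<And>z. z \<in> sphere 0 r \<Longrightarrow> norm (\<phi> z) \<le> \<psi> z"
  shows "norm (circle_mean r \<phi>) \<le> circle_mean r \<psi>"
proof -
  have on: "of_real r * cis t \<in> sphere (0::complex) r" for t
    using r by (simp add: norm_mult)
  have "(\<lambda>t. \<phi> (of_real r * cis t)) integrable_on {0..2 * pi}"
    "(\<lambda>t. \<psi> (of_real r * cis t)) integrable_on {0..2 * pi}"
    by (intro integrable_continuous_interval continuous_on_compose2[OF assms(1)]
        continuous_on_compose2[OF assms(2)] continuous_intros; use on in auto)+
  from integral_norm_bound_integral[OF this le[OF on]]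
  show ?thesis
    by (simp add: circle_mean_def divide_right_mono)
qed

lemma norm_circle_mean_le:
  fixes \<phi> :: "complex \<Rightarrow> 'a::euclidean_space"
  assumes "continuous_on (ball 0 1) \<phi>" "continuous_on (ball 0 1) \<psi>"
    and "\<And>z. z \<in> ball 0 1 \<Longrightarrow> norm (\<phi> z) \<le> \<psi> z"
  shows "norm (circle_mean r \<phi>) \<le> circle_mean r \<psi>"
proof -
  have "sphere 0 r \<subseteq> ball (0::complex) 1" using r by auto
  with assms show ?thesis
    by (intro norm_circle_mean_le_sphere) (blast intro: continuous_on_subset)+
qed

lemma circle_mean_mono:
  fixes \<phi> \<psi> :: "complex \<Rightarrow> real"
  assumes "continuous_on (ball 0 1) \<phi>" "continuous_on (ball 0 1) \<psi>"
    and "\<And>z. z \<in> ball 0 1 \<Longrightarrow> \<phi> z \<le> \<psi> z"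
  shows "circle_mean r \<phi> \<le> circle_mean r \<psi>"
  using integral_le[OF integrable_on_circle[OF assms(1)] integrable_on_circle[OF assms(2)]]
    assms(3)[OF on_circle]
  by (simp add: circle_mean_def divide_right_mono)

text \<open>Cauchy's integral formula: on the circle, \<open>d\<zeta> / (2 \<pi> i (\<zeta> - w))\<close> is \<open>\<zeta> / (\<zeta> - w)\<close>
  times normalized arc length.\<close>
lemma circle_mean_Cauchy:
  assumes "f holomorphic_on ball 0 1" "norm w < r"
  shows "circle_mean r (\<lambda>z. f z * (z / (z - w))) = f w"
proof -
  have "f holomorphic_on cball 0 r"
    using r by (intro holomorphic_on_subset[OF assms(1)]) auto
  then have "((\<lambda>u. f u/(u-w)) has_contour_integral (2 * of_real pi * \<i> * f w)) (circlepath 0 r)"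
    by (rule Cauchy_integral_circlepath_simple) (use assms in simp)
  then have "((\<lambda>t. f (0 + of_real r * cis t) / (0 + of_real r * cis t - w) * of_real r * \<i> * cis t)
      has_integral (2 * of_real pi * \<i> * f w)) {0..2*pi}"
    unfolding circlepath_def by (subst (asm) has_contour_integral_part_circlepath_iff) auto
  from has_integral_mult_right[OF this, of "1 / \<i>"] show ?thesis
    by (auto simp: circle_mean_def has_integral_iff field_simps scaleR_conv_of_real)
qed

lemma circle_mean_holomorphic:
  assumes "f holomorphic_on ball 0 1"
  shows "circle_mean r f = f 0"
proof -
  have "circle_mean r f = circle_mean r (\<lambda>z. f z * (z / (z - 0)))"
    using r by (simp add: circle_mean_def)
  then show ?thesis using circle_mean_Cauchy[OF assms, of 0] r by simp
qed

end

text \<open>Dominated convergence on the boundary circle. Only radial limits almost everywhere are available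
  for inner functions, hence the null-set clause and the passage to the Lebesgue integral.\<close>
lemma circle_mean_tendsto_zero:
  fixes \<phi> :: "complex \<Rightarrow> real" and \<rho> :: "nat \<Rightarrow> real"
  assumes cont: "continuous_on (ball 0 1) \<phi>"
    and \<rho>: "\<And>k. 0 < \<rho> k" "\<And>k. \<rho> k < 1" "\<rho> \<longlonglongrightarrow> 1"
    and bound: "\<And>z. z \<in> ball 0 1 \<Longrightarrow> \<bar>\<phi> z\<bar> \<le> C"
    and radial: "AE t in lebesgue_on {0..2 * pi}. ((\<lambda>r. \<phi> (of_real r * cis t)) \<longlongrightarrow> 0) (at_left 1)"
  shows "(\<lambda>k. circle_mean (\<rho> k) \<phi>) \<longlonglongrightarrow> 0"
proof -
  let ?M = "lebesgue_on {0..2*pi::real}"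
  have at_left: "filterlim \<rho> (at_left 1) sequentially"
    using \<rho> by (auto simp: filterlim_at intro!: always_eventually less_imp_neq)
  have cont': "continuous_on {0..2*pi} (\<lambda>t. \<phi> (of_real (\<rho> k) * cis t))" for k
    by (intro continuous_on_compose2[OF cont] continuous_intros)
       (use on_circle \<rho> in auto)
  have meas: "(\<lambda>t. \<phi> (of_real (\<rho> k) * cis t)) \<in> borel_measurable ?M" for k
    by (intro continuous_imp_measurable_on_sets_lebesgue cont') auto
  have intM: "integrable ?M (\<lambda>t. \<phi> (of_real (\<rho> k) * cis t))" for k
    using absolutely_integrable_continuous_real[OF cont'[of k]] 
    by (simp add: set_integrable_def integrable_restrict_space)
  have "(\<lambda>k. integral\<^sup>L ?M (\<lambda>t. \<phi> (of_real (\<rho> k) * cis t))) \<longlonglongrightarrow> integral\<^sup>L ?M (\<lambda>t. 0)"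
  proof (rule integral_dominated_convergence)
    show "integrable ?M (\<lambda>t. C)"
      using absolutely_integrable_on_const[of "{0..2*pi}" C]
      by (simp add: set_integrable_def integrable_restrict_space)
    show "AE t in ?M. (\<lambda>k. \<phi> (of_real (\<rho> k) * cis t)) \<longlonglongrightarrow> 0"
      using radial by eventually_elim (rule filterlim_compose[OF _ at_left])
    show "AE t in ?M. norm (\<phi> (of_real (\<rho> k) * cis t)) \<le> C" for k
      using bound on_circle[OF \<rho>(1,2)] by auto
  qed (use meas in auto)
  moreover have "integral\<^sup>L ?M (\<lambda>t. \<phi> (of_real (\<rho> k) * cis t))
      = integral {0..2*pi} (\<lambda>t. \<phi> (of_real (\<rho> k) * cis t))" for k
    using lebesgue_integral_eq_integral[OF intM[of k]] by simp
  ultimately show ?thesis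
    using tendsto_mult_left[of _ 0 sequentially "1 / (2*pi)"] by (simp add: circle_mean_def)
qed

section \<open>Inner functions\<close>

lemma inner_holomorphic: "inner_function J \<Longrightarrow> J holomorphic_on ball 0 1"
  by (simp add: inner_function_def)

lemma inner_radial:
  assumes "inner_function J"
  shows "AE t in lebesgue_on {0..2 * pi}. ((\<lambda>r. norm (J (of_real r * cis t))) \<longlongrightarrow> 1) (at_left 1)"
proof -
  from assms have "AE t in lebesgue_on {0..2 * pi}.
        \<exists>l. ((\<lambda>r. J (of_real r * cis t)) \<longlongrightarrow> l) (at_left 1) \<and> norm l = 1"
    by (simp add: inner_function_def)
  then show ?thesis
    by eventually_elim (auto dest: tendsto_norm)
qed

definition radii :: "nat \<Rightarrow> real" where "radii k = 1 - 1 / (k + 2)"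

lemma radii: "0 < radii k" "radii k < 1" "radii \<longlonglongrightarrow> 1"
proof -
  show "radii \<longlonglongrightarrow> 1" using tendsto_diff[OF tendsto_const LIMSEQ_ignore_initial_segment[OF lim_1_over_n, of 2], of 1]
    by (simp add: radii_def[abs_def] add.commute)
qed (auto simp: radii_def field_simps)

text \<open>The way in which the boundary values of an inner function enter every argument below: means of a
  continuous function of the modulus converge to its value at 1.\<close>
lemma inner_mean_tendsto:
  fixes \<psi> :: "real \<Rightarrow> real"
  assumes J: "inner_function J" and cont: "continuous_on {0..} \<psi>"
  shows "(\<lambda>k. circle_mean (radii k) (\<lambda>z. \<psi> (norm (J z)))) \<longlonglongrightarrow> \<psi> 1"
proof -
  have contJ: "continuous_on (ball 0 1) (\<lambda>z. \<psi> (norm (J z)))"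
    using inner_holomorphic[OF J, THEN holomorphic_on_imp_continuous_on]
    by (intro continuous_on_compose2[OF cont] continuous_intros) auto
  obtain B where B: "\<And>z. z \<in> ball 0 1 \<Longrightarrow> norm (J z) \<le> B"
    using J unfolding inner_function_def bounded_iff by blast
  have "bounded (\<psi> ` {0..B})"
    by (intro compact_imp_bounded compact_continuous_image continuous_on_subset[OF cont]) auto
  then obtain C where C: "\<And>x. x \<in> {0..B} \<Longrightarrow> \<bar>\<psi> x\<bar> \<le> C"
    unfolding bounded_iff real_norm_def by blast
  have "(\<lambda>k. circle_mean (radii k) (\<lambda>z. \<psi> (norm (J z)) - \<psi> 1)) \<longlonglongrightarrow> 0"
  proof (rule circle_mean_tendsto_zero[where C="C + \<bar>\<psi> 1\<bar>"])
    show "continuous_on (ball 0 1) (\<lambda>z. \<psi> (norm (J z)) - \<psi> 1)"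
      by (intro continuous_intros contJ)
    show "\<bar>\<psi> (norm (J z)) - \<psi> 1\<bar> \<le> C + \<bar>\<psi> 1\<bar>" if "z \<in> ball 0 1" for z
      using C[of "norm (J z)"] B[OF that] by auto
    have lim: "(\<psi> \<longlongrightarrow> \<psi> 1) (at 1)"
      using continuous_on_interior[OF cont, of 1] by (simp add: isCont_def)
    show "AE t in lebesgue_on {0..2 * pi}.
        ((\<lambda>r. \<psi> (norm (J (of_real r * cis t))) - \<psi> 1) \<longlongrightarrow> 0) (at_left 1)"
      using inner_radial[OF J]
    proof eventually_elim
      case (elim t)
      show ?case
        using tendsto_compose[OF lim elim]
        by (subst LIM_zero_iff)
    qed
  qed (use radii in auto)
  moreover have "circle_mean (radii k) (\<lambda>z. \<psi> (norm (J z)) - \<psi> 1)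
      = circle_mean (radii k) (\<lambda>z. \<psi> (norm (J z))) - \<psi> 1" for k
    by (subst circle_mean_diff) (use radii contJ in auto)
  ultimately show ?thesis by (simp add: LIM_zero_iff)
qed

text \<open>The definition of an inner function asks for boundedness only, and the bound 1 comes from the
  boundary values. Cauchy's formula for the power \<open>J^n\<close> gives
  \<open>\<bar>J z\<bar>^n \<le> 1 / (1 - \<bar>z\<bar>)\<close>; since the right-hand side does not depend on \<open>n\<close>, the modulus of \<open>J z\<close>
  cannot exceed 1.\<close>
lemma inner_norm_le_1:
  assumes J: "inner_function J" and z: "z \<in> ball 0 1"
  shows "norm (J z) \<le> 1"
proof -
  have contJ: "continuous_on (ball 0 1) J"
    by (intro holomorphic_on_imp_continuous_on inner_holomorphic J)
  have bound: "norm (J z) ^ n \<le> 1 / (1 - norm z)" for n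
  proof -
    have "norm (J z) ^ n * (radii k - norm z) \<le> circle_mean (radii k) (\<lambda>u. norm (J u) ^ n)"
      if k: "radii k > norm z" for k
    proof -
      let ?r = "radii k"
      have eq: "circle_mean ?r (\<lambda>u. J u ^ n * (u / (u - z))) = J z ^ n"
        by (rule circle_mean_Cauchy)
           (use radii k in \<open>auto intro!: holomorphic_intros inner_holomorphic[OF J]\<close>)
      have "norm (circle_mean ?r (\<lambda>u. J u ^ n * (u / (u - z))))
        \<le> circle_mean ?r (\<lambda>u. norm (J u) ^ n) / (?r - norm z)"
      proof -
        have sub: "sphere 0 ?r \<subseteq> ball (0::complex) 1" using radii(2)[of k] by auto
        have le: "norm (J u ^ n * (u / (u - z))) \<le> norm (J u) ^ n / (?r - norm z)"
          if u: "u \<in> sphere 0 ?r" for u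
        proof -
          have "?r - norm z \<le> norm (u - z)"
            using norm_triangle_ineq2[of u z] u by simp
          moreover have "?r * norm (J u) ^ n \<le> 1 * norm (J u) ^ n"
            using radii(2)[of k] by (intro mult_right_mono) auto
          ultimately show ?thesis
            using k u radii(1)[of k]
            by (simp add: norm_mult norm_divide norm_power mult.commute frac_le)
        qed
        have "norm (circle_mean ?r (\<lambda>u. J u ^ n * (u / (u - z))))
            \<le> circle_mean ?r (\<lambda>u. norm (J u) ^ n / (?r - norm z))"
          by (intro norm_circle_mean_le_sphere le radii continuous_intros
              continuous_on_subset[OF contJ sub]) (use k in auto)
        also have "\<dots> = circle_mean ?r (\<lambda>u. norm (J u) ^ n) / (?r - norm z)"
          by (simp add: circle_mean_def)
        finally show ?thesis .
      qed
      with eq k show ?thesis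
        by (simp add: norm_power pos_le_divide_eq)
    qed
    moreover have "\<forall>\<^sub>F k in sequentially. radii k > norm z"
      using order_tendstoD(1)[OF radii(3), of "norm z"] z by simp
    ultimately have ev: "\<forall>\<^sub>F k in sequentially.
        norm (J z) ^ n * (radii k - norm z) \<le> circle_mean (radii k) (\<lambda>u. norm (J u) ^ n)"
      by (auto elim: eventually_mono)
    have "norm (J z) ^ n * (1 - norm z) \<le> 1 ^ n"
      by (rule tendsto_le[OF _ inner_mean_tendsto[OF J, of "\<lambda>x. x ^ n"] _ ev])
         (auto intro!: tendsto_intros radii continuous_intros)
    then show ?thesis using z by (simp add: pos_le_divide_eq)
  qed
  show ?thesis
  proof (rule ccontr)
    assume "\<not> norm (J z) \<le> 1"
    then obtain n where "1 / (1 - norm z) < norm (J z) ^ n"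
      using real_arch_pow[of "norm (J z)"] by auto
    with bound[of n] show False by simp
  qed
qed

lemma inner_mult:
  assumes "inner_function I" "inner_function J"
  shows "inner_function (\<lambda>z. I z * J z)"
  unfolding inner_function_def
proof (intro conjI)
  show "(\<lambda>z. I z * J z) holomorphic_on ball 0 1"
    by (intro holomorphic_intros inner_holomorphic assms)
  show "bounded ((\<lambda>z. I z * J z) ` ball 0 1)"
    using inner_norm_le_1[OF assms(1)] inner_norm_le_1[OF assms(2)]
    by (auto simp: bounded_iff norm_mult intro!: exI[of _ 1] mult_le_one)
  have "AE t in lebesgue_on {0..2 * pi}.
        \<exists>l. ((\<lambda>r. I (of_real r * cis t)) \<longlongrightarrow> l) (at_left 1) \<and> norm l = 1"
    "AE t in lebesgue_on {0..2 * pi}.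
        \<exists>l. ((\<lambda>r. J (of_real r * cis t)) \<longlongrightarrow> l) (at_left 1) \<and> norm l = 1"
    using assms by (auto simp: inner_function_def)
  then show "AE t in lebesgue_on {0..2 * pi}.
        \<exists>l. ((\<lambda>r. I (of_real r * cis t) * J (of_real r * cis t)) \<longlongrightarrow> l) (at_left 1) \<and> norm l = 1"
    by eventually_elim (force intro: tendsto_mult simp: norm_mult)
qed

lemma inner_const_1: "inner_function (\<lambda>z. 1)"
  unfolding inner_function_def by (auto simp: bounded_iff intro!: always_eventually exI[of _ 1])

section \<open>Blaschke products\<close>

lemma one_minus_cnj_mult_nz:
  assumes "norm w < 1" "norm z \<le> 1"
  shows "1 - cnj w * z \<noteq> 0"
proof
  assume "1 - cnj w * z = 0"
  then have "norm (cnj w * z) = 1" by (metis eq_iff_diff_eq_0 norm_one)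
  moreover have "norm w * norm z \<le> norm w * 1"
    using assms by (intro mult_left_mono) auto
  ultimately show False using assms by (simp add: norm_mult)
qed

lemma blaschke_factor_inner:
  assumes w: "w \<in> ball 0 1"
  shows "inner_function (\<lambda>z. (z - w) / (1 - cnj w * z))"
proof -
  have nz: "1 - cnj w * z \<noteq> 0" if "z \<in> cball 0 1" for z
    using w that by (intro one_minus_cnj_mult_nz) auto
  have hol: "(\<lambda>z. (z - w) / (1 - cnj w * z)) holomorphic_on cball 0 1"
    using nz by (intro holomorphic_intros) auto
  then have cont: "continuous_on (cball 0 1) (\<lambda>z. (z - w) / (1 - cnj w * z))"
    by (rule holomorphic_on_imp_continuous_on)
  show ?thesis unfolding inner_function_def
  proof (intro conjI always_eventually allI exI)
    show "(\<lambda>z. (z - w) / (1 - cnj w * z)) holomorphic_on ball 0 1"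
      using hol by (rule holomorphic_on_subset) auto
    show "bounded ((\<lambda>z. (z - w) / (1 - cnj w * z)) ` ball 0 1)"
      by (rule bounded_subset[OF compact_imp_bounded[OF compact_continuous_image[OF cont]]]) auto
    fix t :: real
    have "((\<lambda>r. (of_real r * cis t - w) / (1 - cnj w * (of_real r * cis t)))
      \<longlongrightarrow> (of_real 1 * cis t - w) / (1 - cnj w * (of_real 1 * cis t))) (at_left 1)"
      using nz[of "cis t"] by (intro tendsto_intros) auto
    then show "((\<lambda>r. (of_real r * cis t - w) / (1 - cnj w * (of_real r * cis t)))
      \<longlongrightarrow> (cis t - w) / (1 - cnj w * cis t)) (at_left 1)" by simp
    \<comment> \<open>on the unit circle the denominator is a unimodular multiple of the conjugate numerator\<close>
    have "1 - cnj w * cis t = cis t * cnj (cis t - w)"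
      by (simp add: algebra_simps cis_cnj cis_mult)
    then have "norm (1 - cnj w * cis t) = norm (cis t - w)"
      by (simp only: norm_mult complex_mod_cnj norm_cis mult_1)
    then show "norm ((cis t - w) / (1 - cnj w * cis t)) = 1"
      using nz[of "cis t"] by (simp add: norm_divide) force
  qed
qed

lemma blaschke_product_inner:
  assumes "set_mset M \<subseteq> ball 0 1"
  shows "inner_function (\<lambda>z. \<Prod>w\<in>#M. (z - w) / (1 - cnj w * z))"
  using assms
proof (induction M)
  case (add w M)
  then show ?case
    using inner_mult[OF blaschke_factor_inner[of w] add.IH] by simp
qed (simp add: inner_const_1)

text \<open>Each root in the disk is traded for a Blaschke factor and a factor \<open>1 - cnj w * z\<close> that goes into
  the cofactor. The cofactor is kept as a polynomial because then it is plainly bounded on the disk.\<close>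
lemma poly_factor_blaschke:
  fixes q :: "complex poly"
  obtains s where "\<And>z. z \<in> ball 0 1 \<Longrightarrow>
    poly q z = (\<Prod>w\<in>#roots_in_disk q. (z - w) / (1 - cnj w * z)) * poly s z"
proof -
  define A where "A = roots_in_disk q"
  define D where "D = filter_mset (\<lambda>w. w \<notin> ball 0 1) (proots q)"
  have split: "proots q = A + D"
    unfolding A_def D_def roots_in_disk_def by (rule multiset_partition)
  have mset_eq: "(\<Prod>w\<in>#A. -w + z) = (\<Prod>w\<in>#A. (z - w) / (1 - cnj w * z)) * (\<Prod>w\<in>#A. 1 - cnj w * z)"
    if z: "z \<in> ball 0 1" for z
  proof -
    have nz: "1 - cnj w * z \<noteq> 0" if "w \<in># A" for w
      using that z by (intro one_minus_cnj_mult_nz) (auto simp: A_def roots_in_disk_def)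
    show ?thesis
      by (subst prod_mset.distrib[symmetric], rule arg_cong[where f=prod_mset], rule image_mset_cong)
         (use nz in auto)
  qed
  have poly_prod: "poly (\<Prod>w\<in>#M. f w) z = (\<Prod>w\<in>#M. poly (f w) z)"
    for M :: "complex multiset" and f and z :: complex
    by (induction M) auto
  show ?thesis
  proof
    fix z :: complex assume z: "z \<in> ball 0 1"
    have "poly q z = lead_coeff q * ((\<Prod>w\<in>#A. -w + z) * (\<Prod>w\<in>#D. -w + z))"
      by (subst complex_poly_decompose_multiset[symmetric])
         (simp add: split poly_prod)
    also have "\<dots> = (\<Prod>w\<in>#A. (z - w) / (1 - cnj w * z)) *
       poly (smult (lead_coeff q) ((\<Prod>w\<in>#A. [:1, - cnj w:]) * (\<Prod>w\<in>#D. [:-w, 1:]))) z"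
      by (subst mset_eq[OF z]) (simp add: poly_prod mult_ac)
    finally show "poly q z = (\<Prod>w\<in>#roots_in_disk q. (z - w) / (1 - cnj w * z)) *
       poly (smult (lead_coeff q) ((\<Prod>w\<in>#A. [:1, - cnj w:]) * (\<Prod>w\<in>#D. [:-w, 1:]))) z"
      by (simp add: A_def)
  qed
qed

section \<open>Herglotz integrals\<close>

text \<open>The exponent of an outer function. Its real part is the Poisson integral of \<open>h\<close>.\<close>
definition herglotz :: "(real \<Rightarrow> real) \<Rightarrow> complex \<Rightarrow> complex" where
  "herglotz h z = 1 / (2 * of_real pi) *
     integral {0..2 * pi} (\<lambda>t. (cis t + z) / (cis t - z) * of_real (h t))"

lemma cis_minus_nz: "z \<in> ball 0 1 \<Longrightarrow> cis t - z \<noteq> 0"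
  by (metis dist_0_norm eq_iff_diff_eq_0 less_irrefl mem_ball norm_cis)

lemma continuous_times_absolutely_integrable:
  fixes \<phi> :: "real \<Rightarrow> complex"
  assumes "continuous_on {a..b} \<phi>" and h: "h absolutely_integrable_on {a..b}"
  shows "(\<lambda>t. \<phi> t * of_real (h t)) absolutely_integrable_on {a..b}"
proof (rule absolutely_integrable_bounded_measurable_product[OF bilinear_times])
  show "\<phi> \<in> borel_measurable (lebesgue_on {a..b})"
    by (intro continuous_imp_measurable_on_sets_lebesgue assms) auto
  show "bounded (\<phi> ` {a..b})"
    by (intro compact_imp_bounded compact_continuous_image assms) auto
  show "(\<lambda>t. complex_of_real (h t)) absolutely_integrable_on {a..b}"
    using absolutely_integrable_linear[OF h bounded_linear_of_real[where 'a=complex]] by (simp add: o_def)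
qed auto

lemma herglotz_kernel_integrable:
  assumes "h absolutely_integrable_on {0..2*pi}" "z \<in> ball 0 1"
  shows "(\<lambda>t. (cis t + z) / (cis t - z) * of_real (h t)) integrable_on {0..2*pi}"
  by (intro set_lebesgue_integral_eq_integral(1) continuous_times_absolutely_integrable
      continuous_intros assms) (use cis_minus_nz[OF assms(2)] in auto)

lemma herglotz_diff:
  assumes "h absolutely_integrable_on {0..2*pi}" "g absolutely_integrable_on {0..2*pi}" "z \<in> ball 0 1"
  shows "herglotz (\<lambda>t. h t - g t) z = herglotz h z - herglotz g z"
  unfolding herglotz_def of_real_diff right_diff_distrib
  by (subst integral_diff) (simp_all only: right_diff_distrib herglotz_kernel_integrable assms)

text \<open>The real part of the kernel is the Poisson kernel, which is positive.\<close>
lemma Re_herglotz_nonneg: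
  assumes h: "h absolutely_integrable_on {0..2*pi}" and z: "z \<in> ball 0 1"
    and nonneg: "\<And>t. 0 \<le> h t"
  shows "0 \<le> Re (herglotz h z)"
proof -
  let ?K = "\<lambda>t. (cis t + z) / (cis t - z)"
  have Re_K: "0 \<le> Re (?K t)" for t
  proof -
    have "?K t = (cis t + z) * cnj (cis t - z) / of_real ((norm (cis t - z))\<^sup>2)"
      by (simp only: complex_div_cnj[of "cis t + z" "cis t - z"] of_real_power)
    moreover have "Re ((cis t + z) * cnj (cis t - z)) = (norm (cis t))\<^sup>2 - (norm z)\<^sup>2"
      unfolding cmod_power2 by (simp add: algebra_simps power2_eq_square)
    moreover have "(norm z)\<^sup>2 \<le> 1"
      using z by (simp add: power_le_one)
    ultimately show ?thesis by (simp only: Re_divide_of_real norm_cis) simp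
  qed
  have "Re (integral {0..2*pi} (\<lambda>t. ?K t * of_real (h t))) =
      integral {0..2*pi} (\<lambda>t. Re (?K t * of_real (h t)))"
    using integral_linear[OF herglotz_kernel_integrable[OF h z] bounded_linear_Re] by (simp add: o_def)
  also have "\<dots> \<ge> 0"
  proof (rule integral_nonneg)
    show "(\<lambda>t. Re (?K t * of_real (h t))) integrable_on {0..2*pi}"
      using integrable_linear[OF herglotz_kernel_integrable[OF h z] bounded_linear_Re] by (simp add: o_def)
    show "0 \<le> Re (?K t * of_real (h t))" for t
      using Re_K[of t] nonneg[of t] 
        by (simp only: times_complex.sel Re_complex_of_real Im_complex_of_real mult_zero_right diff_zero
            mult_nonneg_nonneg)
  qed
  finally have "0 \<le> Re (integral {0..2*pi} (\<lambda>t. ?K t * of_real (h t)))" .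
  moreover have "herglotz h z = integral {0..2*pi} (\<lambda>t. ?K t * of_real (h t)) / of_real (2 * pi)"
    by (simp add: herglotz_def)
  ultimately show ?thesis by (simp only: Re_divide_of_real) simp
qed

text \<open>The conjugate of the kernel is, as a function of the boundary point, the restriction of a function
  holomorphic in a disk larger than the unit disk, so its mean is its value 1 at the origin.\<close>
lemma herglotz_const:
  assumes z: "z \<in> ball 0 1"
  shows "herglotz (\<lambda>t. c) z = of_real c"
proof -
  obtain \<rho> where \<rho>: "norm z < \<rho>" "\<rho> < 1" using dense[of "norm z" 1] z by auto
  then have \<rho>0: "0 < \<rho>" using norm_ge_zero[of z] by linarith
  \<comment> \<open>the conjugate kernel, rescaled so that the unit circle becomes the circle of radius \<open>\<rho> < 1\<close>\<close>
  let ?G = "\<lambda>\<zeta>. (1 + cnj z * (\<zeta> / of_real \<rho>)) / (1 - cnj z * (\<zeta> / of_real \<rho>))"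
  have nz: "1 - cnj z * (\<zeta> / of_real \<rho>) \<noteq> 0" if "\<zeta> \<in> ball 0 1" for \<zeta>
    using one_minus_cnj_mult_nz[of "z / of_real \<rho>" \<zeta>] \<rho> \<rho>0 that by (simp add: norm_divide)
  have "?G holomorphic_on ball 0 1"
    using nz \<rho>0 by (intro holomorphic_intros) auto
  from circle_mean_holomorphic[OF \<rho>0 \<rho>(2) this]
  have "circle_mean \<rho> ?G = 1" by simp
  moreover have "X = of_real (2 * pi)" if "(1 / (2 * pi)) *\<^sub>R X = 1" for X :: complex
    using that by (simp add: scaleR_conv_of_real field_simps)
  ultimately have "integral {0..2*pi} (\<lambda>t. ?G (of_real \<rho> * cis t)) = of_real (2 * pi)"
    unfolding circle_mean_def by blast
  moreover have "?G (of_real \<rho> * cis t) = cnj ((cis t + z) / (cis t - z))" for t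
  proof -
    have "cnj (cis t + z) = cnj (cis t) * (1 + cnj z * cis t)"
      "cnj (cis t - z) = cnj (cis t) * (1 - cnj z * cis t)"
      by (simp_all add: algebra_simps cis_cnj cis_mult)
    then show ?thesis using \<rho>0 by simp
  qed
  ultimately have "integral {0..2*pi} (\<lambda>t. cnj ((cis t + z) / (cis t - z))) = of_real (2 * pi)"
    by (simp only:)
  moreover have "(\<lambda>t. (cis t + z) / (cis t - z)) integrable_on {0..2*pi}"
    by (intro integrable_continuous_interval continuous_intros) (use cis_minus_nz[OF z] in auto)
  then have "integral {0..2*pi} (\<lambda>t. cnj ((cis t + z) / (cis t - z)))
      = cnj (integral {0..2*pi} (\<lambda>t. (cis t + z) / (cis t - z)))"
    using integral_linear[OF _ bounded_linear_cnj] by (simp only: o_def)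
  ultimately have "integral {0..2*pi} (\<lambda>t. (cis t + z) / (cis t - z)) = of_real (2 * pi)"
    by (metis complex_cnj_cnj complex_cnj_complex_of_real)
  then show ?thesis by (simp only: herglotz_def integral_mult_left) simp
qed

lemma Re_herglotz_le:
  assumes h: "h absolutely_integrable_on {0..2*pi}" and z: "z \<in> ball 0 1"
    and le: "\<And>t. h t \<le> c"
  shows "Re (herglotz h z) \<le> c"
proof -
  have c: "(\<lambda>t. c) absolutely_integrable_on {0..2*pi}"
    by simp
  have "0 \<le> Re (herglotz (\<lambda>t. c - h t) z)"
    by (intro Re_herglotz_nonneg set_integral_diff(1) c h z) (use le in auto)
  then show ?thesis by (simp add: herglotz_diff[OF c h z] herglotz_const[OF z])
qed

text \<open>For merely integrable \<open>h\<close>, differentiation under the integral sign is done by hand: the difference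
  quotients of the kernel at \<open>w\<close> are bounded by a constant near \<open>w\<close>, so a constant multiple of \<open>\<bar>h\<bar>\<close>
  dominates.\<close>
lemma herglotz_holomorphic:
  assumes h: "h absolutely_integrable_on {0..2*pi}"
  shows "herglotz h holomorphic_on ball 0 1"
proof -
  have "herglotz h field_differentiable at w" if w: "w \<in> ball 0 1" for w
  proof -
    define \<delta> where "\<delta> = (1 - norm w) / 2"
    have \<delta>: "0 < \<delta>" using w by (simp add: \<delta>_def)
    have far: "\<delta> \<le> norm (cis t - u)" if "u \<in> ball w \<delta>" for t u
    proof -
      have "norm u \<le> norm w + dist w u"
        using norm_triangle_ineq[of w "u - w"] by (simp add: dist_norm norm_minus_commute)
      then show ?thesis
        using that norm_triangle_ineq2[of "cis t" u] by (auto simp: \<delta>_def)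
    qed
    have sub: "u \<in> ball 0 1" if "u \<in> ball w \<delta>" for u
    proof -
      have "norm u \<le> norm w + dist w u"
        using norm_triangle_ineq[of w "u - w"] by (simp add: dist_norm norm_minus_commute)
      then show ?thesis using that w by (auto simp: \<delta>_def)
    qed
    let ?Q = "\<lambda>u t. 2 * cis t / ((cis t - u) * (cis t - w)) * of_real (h t)"
    have quot: "(herglotz h u - herglotz h w) / (u - w) = 1 / (2 * of_real pi) * integral {0..2*pi} (?Q u)"
      if u: "u \<in> ball w \<delta> - {w}" for u
    proof -
      have ub: "u \<in> ball 0 1" using sub u by auto
      have "(cis t + u) / (cis t - u) * of_real (h t) - (cis t + w) / (cis t - w) * of_real (h t)
         = (u - w) * ?Q u t" for t
        using cis_minus_nz[OF ub, of t] cis_minus_nz[OF w, of t] by (simp add: divide_simps) (simp add: algebra_simps)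
      then have "integral {0..2*pi} (\<lambda>t. (cis t + u) / (cis t - u) * of_real (h t))
          - integral {0..2*pi} (\<lambda>t. (cis t + w) / (cis t - w) * of_real (h t))
          = (u - w) * integral {0..2*pi} (?Q u)"
        by (simp only: integral_diff[symmetric] herglotz_kernel_integrable[OF h ub]
            herglotz_kernel_integrable[OF h w] integral_mult_right)
      then show ?thesis using u
        by (simp add: herglotz_def divide_simps)
    qed
    have Q_int: "?Q u integrable_on {0..2*pi}" if "u \<in> ball w \<delta>" for u
      by (intro set_lebesgue_integral_eq_integral(1) continuous_times_absolutely_integrable
            continuous_intros h) (use cis_minus_nz sub[OF that] w in auto)
    have "((\<lambda>u. (herglotz h u - herglotz h w) / (u - w)) \<longlongrightarrow>
        1 / (2 * of_real pi) * integral {0..2*pi} (?Q w)) (at w within ball w \<delta>)"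
      unfolding tendsto_at_iff_sequentially o_def
    proof (intro allI impI)
      fix X assume X: "\<forall>i. X i \<in> ball w \<delta> - {w}" "X \<longlonglongrightarrow> w"
      have "(\<lambda>i. integral {0..2*pi} (?Q (X i))) \<longlonglongrightarrow> integral {0..2*pi} (?Q w)"
      proof (rule dominated_convergence(2)[where h="\<lambda>t. 2 / (\<delta> * \<delta>) * \<bar>h t\<bar>"])
        show "?Q (X i) integrable_on {0..2*pi}" for i
          using X by (intro Q_int) auto
        show "(\<lambda>t. 2 / (\<delta> * \<delta>) * \<bar>h t\<bar>) integrable_on {0..2*pi}"
          using integrable_cmul[of "\<lambda>t. \<bar>h t\<bar>" _ "2 / (\<delta> * \<delta>)"] h
          by (simp add: absolutely_integrable_on_def)
        show "norm (?Q (X i) t) \<le> 2 / (\<delta> * \<delta>) * \<bar>h t\<bar>" for i t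
        proof -
          have "\<delta> * \<delta> \<le> norm (cis t - X i) * norm (cis t - w)"
            using far[of "X i" t] far[of w t] X \<delta> by (intro mult_mono) auto
          then have "2 / (norm (cis t - X i) * norm (cis t - w)) \<le> 2 / (\<delta> * \<delta>)"
            using \<delta> by (intro divide_left_mono) (auto intro: mult_pos_pos less_le_trans)
          from mult_right_mono[OF this, of "\<bar>h t\<bar>"] show ?thesis
            by (simp add: norm_mult norm_divide)
        qed
        show "(\<lambda>i. ?Q (X i) t) \<longlonglongrightarrow> ?Q w t" for t
          by (intro tendsto_intros X) (use cis_minus_nz[OF w] in auto)
      qed
      then have "(\<lambda>i. 1 / (2 * of_real pi) * integral {0..2*pi} (?Q (X i)))
          \<longlonglongrightarrow> 1 / (2 * of_real pi) * integral {0..2*pi} (?Q w)"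
        by (rule tendsto_mult_left)
      then show "(\<lambda>i. (herglotz h (X i) - herglotz h w) / (X i - w))
          \<longlonglongrightarrow> 1 / (2 * of_real pi) * integral {0..2*pi} (?Q w)"
        using quot X(1) by simp
    qed
    then have "herglotz h field_differentiable at w within ball w \<delta>"
      unfolding field_differentiable_def has_field_derivative_iff by blast
    then show ?thesis
      using field_differentiable_within_open[of w "ball w \<delta>" "herglotz h"] \<delta> by (metis centre_in_ball open_ball)
  qed
  then show ?thesis
    unfolding holomorphic_on_def by (blast intro: field_differentiable_at_within)
qed

text \<open>Cutting \<open>h\<close> off at height \<open>N\<close> changes the outer function by a factor whose value at the origin
  tends to 1.\<close>
lemma herglotz_excess_tendsto:
  fixes h :: "real \<Rightarrow> real"
  assumes h: "h absolutely_integrable_on {0..2*pi}"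
  shows "(\<lambda>N. herglotz (\<lambda>t. max 0 (h t - real N)) 0) \<longlonglongrightarrow> 0"
proof -
  have "(\<lambda>N. integral {0..2*pi} (\<lambda>t. complex_of_real (max 0 (h t - real N))))
      \<longlonglongrightarrow> integral {0..2*pi} (\<lambda>t. 0)"
  proof (rule dominated_convergence(2)[where h="\<lambda>t. \<bar>h t\<bar>"])
    show "(\<lambda>t. complex_of_real (max 0 (h t - real N))) integrable_on {0..2*pi}" for N
    proof -
      have "(\<lambda>t. max 0 (h t - real N)) absolutely_integrable_on {0..2*pi}"
        by (intro absolutely_integrable_max_1 set_integral_diff(1) h absolutely_integrable_on_const) auto
      then have "(\<lambda>t. max 0 (h t - real N)) integrable_on {0..2*pi}"
        by (simp add: absolutely_integrable_on_def)
      from integrable_linear[OF this bounded_linear_of_real] show ?thesis by (simp add: o_def)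
    qed
    show "(\<lambda>t. \<bar>h t\<bar>) integrable_on {0..2*pi}"
      using h by (simp add: absolutely_integrable_on_def)
    show "norm (complex_of_real (max 0 (h t - real N))) \<le> \<bar>h t\<bar>" for N t
      by (simp only: norm_of_real)
    show "(\<lambda>N. complex_of_real (max 0 (h t - real N))) \<longlonglongrightarrow> 0" for t
    proof (rule tendsto_eventually)
      obtain M where "h t < real M" using reals_Archimedean2 by blast
      then show "\<forall>\<^sub>F N in sequentially. complex_of_real (max 0 (h t - real N)) = 0"
        by (intro eventually_sequentiallyI[of M]) auto
    qed
  qed
  from tendsto_mult_left[OF this, of "1 / (2 * of_real pi)"] show ?thesis
    by (simp add: herglotz_def)
qed

section \<open>The distance from 1 to the multiples of an inner function\<close>

lemma circle_mean_power2_le: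
  fixes \<phi> :: "complex \<Rightarrow> real"
  assumes r: "0 < r" "r < 1" and cont: "continuous_on (ball 0 1) \<phi>"
  shows "(circle_mean r \<phi>)\<^sup>2 \<le> circle_mean r (\<lambda>z. (\<phi> z)\<^sup>2)"
proof -
  let ?m = "circle_mean r \<phi>"
  have "0 = circle_mean r (\<lambda>z. 0 :: real)" using r by simp
  also have "\<dots> \<le> circle_mean r (\<lambda>z. (\<phi> z)\<^sup>2 - (2 * ?m) * \<phi> z + ?m\<^sup>2)"
  proof (intro circle_mean_mono r continuous_intros cont)
    show "0 \<le> (\<phi> z)\<^sup>2 - (2 * ?m) * \<phi> z + ?m\<^sup>2" for z
      using zero_le_power2[of "\<phi> z - ?m"] by (simp add: power2_diff algebra_simps)
  qed
  also have "\<dots> = circle_mean r (\<lambda>z. (\<phi> z)\<^sup>2) - (2 * ?m) * ?m + ?m\<^sup>2"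
    by (simp only: circle_mean_add[OF r] circle_mean_diff[OF r] circle_mean_mult[OF r]
        circle_mean_const[OF r] cont continuous_on_add continuous_on_diff continuous_on_mult_left
        continuous_on_power continuous_on_const)
  finally show ?thesis by (simp add: power2_eq_square)
qed

text \<open>The power equals 1 at the origin, so it is congruent to 1 modulo \<open>w\<close>. After substituting an inner
  function \<open>I\<close> for \<open>w\<close>, it is congruent to 1 modulo \<open>I\<close>.\<close>
lemma powr_minus_one_divisible:
  fixes a :: complex and s :: real
  assumes "norm a < 1"
  obtains \<psi> where "\<psi> holomorphic_on {w. 0 < Re (1 - cnj a * w)}"
    and "\<And>w. (1 - cnj a * w) powr of_real s = 1 + w * \<psi> w"
proof -
  let ?S = "{w. 0 < Re (1 - cnj a * w)}"
  let ?\<phi> = "\<lambda>w. (1 - cnj a * w) powr of_real s - 1"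
  let ?\<psi> = "\<lambda>w. if w = 0 then deriv ?\<phi> 0 else ?\<phi> w / w - ?\<phi> 0 / (w - 0)"
  have "open ?S"
    by (intro open_Collect_less continuous_intros)
  then have int: "0 \<in> interior ?S" by (simp add: interior_open)
  have hol: "?\<phi> holomorphic_on ?S"
    by (intro holomorphic_intros) (auto simp: complex_nonpos_Reals_iff)
  have "?\<psi> holomorphic_on ?S"
    by (rule pole_theorem[OF hol int]) auto
  then show ?thesis
    by (rule that) auto
qed

text \<open>The core estimate. Put \<open>a = I 0\<close>, \<open>u = 1 - cnj a * I\<close> and \<open>v = u powr (1 - 2 / p)\<close>, and let \<open>X\<close> be the
  mean of \<open>(e - I H) v cnj u\<close> over a circle of radius \<open>r\<close>. On the unit circle \<open>I * cnj I = 1\<close>, so that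
  \<open>cnj u\<close> annihilates every multiple \<open>I L\<close> of \<open>I\<close>: the mean of \<open>I L (1 - a cnj I)\<close> is
  \<open>a L(0) - a L(0) = 0\<close>. As \<open>v\<close> is 1 modulo \<open>I\<close>, only the mean of \<open>e cnj u\<close> remains, and it is close to
  \<open>1 - \<bar>a\<bar>\<^sup>2\<close> when \<open>e\<close> is close to 1. In the other direction,
  \<open>\<bar>v cnj u\<bar> = \<bar>u\<bar> powr (2 / q)\<close> for the conjugate exponent \<open>q\<close>, so Young's inequality bounds
  \<open>\<bar>X\<bar>\<close> by \<open>1 / p\<close> times the mean of \<open>\<bar>g\<bar> powr p\<close> plus \<open>1 / q\<close> times the mean of \<open>\<bar>u\<bar>\<^sup>2\<close>, and the latter
  mean is at most \<open>1 - \<bar>a\<bar>\<^sup>2\<close>.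

  The exponent in \<open>v\<close> makes this sharp: Young's inequality is an equality for \<open>g = u powr (2 / p)\<close>, which is
  again 1 modulo \<open>I\<close>. On circles of radius \<open>r < 1\<close> the relation
  \<open>I * cnj I = 1\<close> fails by \<open>1 - \<bar>I\<bar>\<^sup>2\<close>, whose mean tends to 0; boundedness of \<open>H\<close> is what lets this defect be
  neglected. The function \<open>e\<close> pays for that boundedness, and the last two terms of the estimate measure
  its distance from 1.\<close>
lemma inner_truncated_estimate:
  fixes p M :: real
  assumes p: "1 < p" and I: "inner_function I" and a: "norm (I 0) < 1"
    and e: "e holomorphic_on ball 0 1" "\<And>z. z \<in> ball 0 1 \<Longrightarrow> norm (e z) \<le> 1"
    and H: "H holomorphic_on ball 0 1" "\<And>z. z \<in> ball 0 1 \<Longrightarrow> norm (H z) \<le> K"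
    and g: "continuous_on (ball 0 1) g"
      "\<And>z. z \<in> ball 0 1 \<Longrightarrow> norm (e z - I z * H z) \<le> norm (g z)"
    and M: "\<And>r. 0 < r \<Longrightarrow> r < 1 \<Longrightarrow> circle_mean r (\<lambda>z. norm (g z) powr p) \<le> M"
  shows "1 - (norm (I 0))\<^sup>2 \<le> M / p + (1 - (norm (I 0))\<^sup>2) * (1 - 1 / p)
    + (norm (1 - e 0) + sqrt (2 - 2 * Re (e 0)))"
proof -
  define a where "a = I 0"
  define s where "s = 1 - 2 / p"
  define u where "u z = 1 - cnj a * I z" for z
  define v where "v z = u z powr of_real s" for z
  have a1: "norm a < 1" using \<open>norm (I 0) < 1\<close> by (simp add: a_def)
  have I1: "norm (I z) \<le> 1" if "z \<in> ball 0 1" for z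
    using inner_norm_le_1[OF I that] .
  have holI: "I holomorphic_on ball 0 1" by (rule inner_holomorphic[OF I])
  obtain \<psi> where \<psi>: "\<psi> holomorphic_on {w. 0 < Re (1 - cnj a * w)}"
    "\<And>w. (1 - cnj a * w) powr of_real s = 1 + w * \<psi> w"
    using powr_minus_one_divisible[OF a1] by blast
  have half: "0 < Re (1 - cnj a * w)" if "norm w \<le> 1" for w
  proof -
    have "Re (cnj a * w) \<le> norm a * norm w"
      using complex_Re_le_cmod[of "cnj a * w"] by (simp only: norm_mult complex_mod_cnj)
    also have "\<dots> \<le> norm a * 1" using that by (intro mult_left_mono) auto
    finally show ?thesis using a1 by (simp only: minus_complex.sel one_complex.sel)
  qed
  define k where "k z = \<psi> (I z)" for z
  have v_eq: "v z = 1 + I z * k z" for z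
    by (simp add: v_def u_def k_def \<psi>(2))
  have holk: "k holomorphic_on ball 0 1"
    unfolding k_def
    by (rule holomorphic_on_compose_gen[OF holI \<psi>(1), unfolded o_def]) (use half I1 in blast)
  have holv: "v holomorphic_on ball 0 1"
    unfolding v_eq[abs_def] by (intro holomorphic_intros holI holk)
  have "bounded (\<psi> ` cball 0 1)"
    by (intro compact_imp_bounded compact_continuous_image
        continuous_on_subset[OF holomorphic_on_imp_continuous_on[OF \<psi>(1)]])
       (use half in auto)
  then obtain Bk where Bk: "\<And>w. w \<in> cball 0 1 \<Longrightarrow> norm (\<psi> w) \<le> Bk"
    unfolding bounded_iff by blast
  have k_le: "norm (k z) \<le> Bk" if "z \<in> ball 0 1" for z
    using Bk[of "I z"] I1[OF that] by (simp add: k_def)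
  have v_le: "norm (v z) \<le> 1 + Bk" if "z \<in> ball 0 1" for z
  proof -
    have "norm (v z) \<le> 1 + norm (I z) * norm (k z)"
      unfolding v_eq using norm_triangle_ineq[of 1 "I z * k z"] by (simp add: norm_mult)
    also have "\<dots> \<le> 1 + 1 * Bk"
      using I1[OF that] k_le[OF that] by (intro add_left_mono mult_mono) auto
    finally show ?thesis by simp
  qed
  define L where "L z = e z * k z - H z * v z" for z
  define C where "C = Bk + K * (1 + Bk)"
  have holL: "L holomorphic_on ball 0 1"
    unfolding L_def by (intro holomorphic_intros e H holk holv)
  have L_le: "norm (L z) \<le> C" if "z \<in> ball 0 1" for z
  proof -
    have "norm (L z) \<le> norm (e z) * norm (k z) + norm (H z) * norm (v z)"
      unfolding L_def using norm_triangle_ineq4[of "e z * k z" "H z * v z"] by (simp add: norm_mult)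
    also have "\<dots> \<le> 1 * Bk + K * (1 + Bk)"
      using e(2)[OF that] k_le[OF that] H(2)[OF that] v_le[OF that]
      by (intro add_mono mult_mono) (auto intro: order_trans[OF norm_ge_zero])
    finally show ?thesis by (simp add: C_def)
  qed
  note cont [continuous_intros] =
    holI[THEN holomorphic_on_imp_continuous_on] e(1)[THEN holomorphic_on_imp_continuous_on]
    H(1)[THEN holomorphic_on_imp_continuous_on] holv[THEN holomorphic_on_imp_continuous_on]
    holL[THEN holomorphic_on_imp_continuous_on] g(1)
  have contu [continuous_intros]: "continuous_on (ball 0 1) u"
    unfolding u_def by (intro continuous_intros)
  have u_nz: "u z \<noteq> 0" if "z \<in> ball 0 1" for z
    using half[OF I1[OF that]] unfolding u_def by (metis less_irrefl zero_complex.sel(1))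
  define d where "d = 1 - (norm a)\<^sup>2"
  define \<epsilon> where "\<epsilon> = norm (1 - e 0) + sqrt (2 - 2 * Re (e 0))"
  define D where "D r = circle_mean r (\<lambda>z. 1 - (norm (I z))\<^sup>2)" for r
  \<comment> \<open>the last term is the defect \<open>1 - \<bar>I\<bar>\<^sup>2\<close> on the circle of radius \<open>r\<close>\<close>
  have main: "d \<le> M / p + d * (1 - 1 / p) + \<epsilon> + C * D r" if r: "0 < r" "r < 1" for r
  proof -
    define X where "X = circle_mean r (\<lambda>z. (e z - I z * H z) * v z * cnj (u z))"
    have pointwise: "(e z - I z * H z) * v z * cnj (u z)
        = e z + I z * L z - a * cnj (I z) + a * ((1 - e z) * cnj (I z)) - a * L z
          + a * (of_real (1 - (norm (I z))\<^sup>2) * L z)" for z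
    proof -
      have "(e z - I z * H z) * v z = e z + I z * L z"
        unfolding L_def by (simp add: v_eq algebra_simps)
      moreover have "cnj (u z) = 1 - a * cnj (I z)" by (simp add: u_def)
      moreover have "complex_of_real (1 - (norm (I z))\<^sup>2) = 1 - I z * cnj (I z)"
        by (simp only: of_real_diff of_real_1 complex_norm_square)
      ultimately show ?thesis by (simp only:) (simp add: algebra_simps)
    qed
    define E1 where "E1 = circle_mean r (\<lambda>z. (1 - e z) * cnj (I z))"
    define E2 where "E2 = circle_mean r (\<lambda>z. of_real (1 - (norm (I z))\<^sup>2) * L z)"
    have cnjI: "circle_mean r (\<lambda>z. cnj (I z)) = cnj a"
      using circle_mean_linear[OF r cont(1) bounded_linear_cnj] circle_mean_holomorphic[OF r holI]
      by (simp add: a_def)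
    have conts: "continuous_on (ball 0 1) (\<lambda>z. I z * L z)"
      "continuous_on (ball 0 1) (\<lambda>z. cnj (I z))"
      "continuous_on (ball 0 1) (\<lambda>z. (1 - e z) * cnj (I z))"
      "continuous_on (ball 0 1) (\<lambda>z. of_real (1 - (norm (I z))\<^sup>2) * L z)"
      by (intro continuous_intros)+
    have "X = e 0 + I 0 * L 0 - a * cnj a + a * E1 - a * L 0 + a * E2"
      unfolding X_def pointwise E1_def E2_def
      by (simp only: circle_mean_add[OF r] circle_mean_diff[OF r] circle_mean_mult[OF r] cnjI
          continuous_on_add continuous_on_diff continuous_on_mult_left conts cont
          circle_mean_holomorphic[OF r] e(1) holL holI holomorphic_on_mult)
    then have "of_real d = X + ((1 - e 0) - a * E1 - a * E2)"
      by (simp only: d_def of_real_diff of_real_1 complex_norm_square) (simp add: a_def)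
    then have "\<bar>d\<bar> \<le> norm X + norm ((1 - e 0) - a * E1 - a * E2)"
      by (metis norm_of_real norm_triangle_ineq)
    also have "norm ((1 - e 0) - a * E1 - a * E2) \<le> norm (1 - e 0) + norm (a * E1) + norm (a * E2)"
      by (meson norm_triangle_ineq4 order_trans add_mono order_refl)
    also have "norm (a * E1) \<le> sqrt (2 - 2 * Re (e 0))"
    proof -
      have "norm (a * E1) \<le> 1 * norm E1"
        unfolding norm_mult using a1 by (intro mult_right_mono) auto
      also have "1 * norm E1 \<le> circle_mean r (\<lambda>z. norm (1 - e z))"
        unfolding E1_def mult_1
      proof (intro norm_circle_mean_le r continuous_intros)
        show "norm ((1 - e z) * cnj (I z)) \<le> norm (1 - e z)" if "z \<in> ball 0 1" for z
          using mult_left_mono[OF I1[OF that], of "norm (1 - e z)"] by (simp add: norm_mult)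
      qed
      also have "\<dots> \<le> sqrt (2 - 2 * Re (e 0))"
      proof (rule real_le_rsqrt)
        \<comment> \<open>a function bounded by 1 whose mean is close to 1 is close to 1 in quadratic mean\<close>
        have "(circle_mean r (\<lambda>z. norm (1 - e z)))\<^sup>2 \<le> circle_mean r (\<lambda>z. (norm (1 - e z))\<^sup>2)"
          by (intro circle_mean_power2_le r continuous_intros)
        also have "\<dots> \<le> circle_mean r (\<lambda>z. 2 - 2 * Re (e z))"
        proof (intro circle_mean_mono r continuous_intros)
          show "(norm (1 - e z))\<^sup>2 \<le> 2 - 2 * Re (e z)" if "z \<in> ball 0 1" for z
          proof -
            have "(norm (1 - e z))\<^sup>2 = 1 - 2 * Re (e z) + (norm (e z))\<^sup>2"
              unfolding cmod_power2 by (simp add: power2_eq_square algebra_simps)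
            moreover have "(norm (e z))\<^sup>2 \<le> 1" using e(2)[OF that] by (simp add: power_le_one)
            ultimately show ?thesis by simp
          qed
        qed
        also have "\<dots> = 2 - 2 * Re (e 0)"
          by (simp only: circle_mean_diff[OF r] circle_mean_mult[OF r] circle_mean_const[OF r]
              circle_mean_linear[OF r cont(2) bounded_linear_Re] circle_mean_holomorphic[OF r e(1)]
              continuous_on_mult_left continuous_on_const continuous_on_Re cont)
        finally show "(circle_mean r (\<lambda>z. norm (1 - e z)))\<^sup>2 \<le> 2 - 2 * Re (e 0)" .
      qed
      finally show ?thesis .
    qed
    also have "norm (a * E2) \<le> C * D r"
    proof -
      have "norm (a * E2) \<le> 1 * norm E2"
        unfolding norm_mult using a1 by (intro mult_right_mono) auto
      also have "1 * norm E2 \<le> circle_mean r (\<lambda>z. C * (1 - (norm (I z))\<^sup>2))"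
        unfolding E2_def mult_1
      proof (intro norm_circle_mean_le r continuous_intros)
        fix z :: complex assume z: "z \<in> ball 0 1"
        have "(norm (I z))\<^sup>2 \<le> 1" using I1[OF z] by (simp add: power_le_one)
        then show "norm (of_real (1 - (norm (I z))\<^sup>2) * L z) \<le> C * (1 - (norm (I z))\<^sup>2)"
          unfolding norm_mult norm_of_real
          using mult_left_mono[OF L_le[OF z], of "1 - (norm (I z))\<^sup>2"] by (simp add: mult.commute)
      qed
      also have "\<dots> = C * D r"
        unfolding D_def by (rule circle_mean_mult[OF r])
      finally show ?thesis .
    qed
    also have "norm X \<le> M / p + d * (1 - 1 / p)"
    proof -
      define q where "q = p / (p - 1)"
      have q: "1 < q" "1 / p + 1 / q = 1" using p by (auto simp: q_def field_simps)
      have "norm X \<le> circle_mean r (\<lambda>z. norm (g z) powr p * (1 / p) + (norm (u z))\<^sup>2 * (1 / q))"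
        unfolding X_def
      proof (rule norm_circle_mean_le[OF r])
        show "continuous_on (ball 0 1) (\<lambda>z. (e z - I z * H z) * v z * cnj (u z))"
          by (intro continuous_intros)
        have "continuous_on (ball 0 1) (\<lambda>z. (norm (u z))\<^sup>2)"
          by (intro continuous_intros)
        then show "continuous_on (ball 0 1)
            (\<lambda>z. norm (g z) powr p * (1 / p) + (norm (u z))\<^sup>2 * (1 / q))"
          using p by (intro continuous_on_add continuous_on_mult_right continuous_on_norm_powr g(1)) auto
        fix z :: complex assume z: "z \<in> ball 0 1"
        have nu: "0 < norm (u z)" using u_nz[OF z] by simp
        have "norm ((e z - I z * H z) * v z * cnj (u z))
          = norm (e z - I z * H z) * (norm (u z) powr s * norm (u z) powr 1)"
          using nu by (simp add: norm_mult v_def norm_powr_real_powr')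
        also have "norm (u z) powr s * norm (u z) powr 1 = norm (u z) powr (2 / q)"
        proof -
          have "s + 1 = 2 / q" using p by (simp add: s_def q_def field_simps)
          then show ?thesis by (simp only: powr_add[symmetric])
        qed
        also have "norm (e z - I z * H z) * norm (u z) powr (2 / q)
            \<le> norm (g z) * norm (u z) powr (2 / q)"
          by (intro mult_right_mono g z) auto
        also have "\<dots> \<le> norm (g z) powr p / p + (norm (u z) powr (2 / q)) powr q / q"
          by (rule Youngs_inequality) (use p q in auto)
        also have "(norm (u z) powr (2 / q)) powr q = (norm (u z))\<^sup>2"
          using q nu by (simp add: powr_powr)
        finally show "norm ((e z - I z * H z) * v z * cnj (u z))
          \<le> norm (g z) powr p * (1 / p) + (norm (u z))\<^sup>2 * (1 / q)" by simp
      qed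
      also have "\<dots> = circle_mean r (\<lambda>z. norm (g z) powr p) * (1 / p)
          + circle_mean r (\<lambda>z. (norm (u z))\<^sup>2) * (1 / q)"
      proof -
        have c1: "continuous_on (ball 0 1) (\<lambda>z. norm (g z) powr p)"
          by (intro continuous_on_norm_powr g(1)) (use p in auto)
        have c2: "continuous_on (ball 0 1) (\<lambda>z. (norm (u z))\<^sup>2)"
          by (intro continuous_intros)
        show ?thesis
          by (simp only: circle_mean_add[OF r] circle_mean_mult[OF r] c1 c2 continuous_on_mult_right)
      qed
      also have "\<dots> \<le> M * (1 / p) + d * (1 / q)"
      proof (intro add_mono mult_right_mono M r)
        have "circle_mean r (\<lambda>z. (norm (u z))\<^sup>2)
          \<le> circle_mean r (\<lambda>z. (1 + (norm a)\<^sup>2) - Re (2 * cnj a * I z))"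
        proof (intro circle_mean_mono r continuous_intros)
          fix z :: complex assume z: "z \<in> ball 0 1"
          have "(norm (u z))\<^sup>2 = 1 - Re (2 * cnj a * I z) + (norm a)\<^sup>2 * (norm (I z))\<^sup>2"
            unfolding cmod_power2 by (simp add: u_def power2_eq_square algebra_simps)
          moreover have "(norm a)\<^sup>2 * (norm (I z))\<^sup>2 \<le> (norm a)\<^sup>2 * 1"
            using I1[OF z] by (intro mult_left_mono) (auto simp: power_le_one)
          ultimately show "(norm (u z))\<^sup>2 \<le> (1 + (norm a)\<^sup>2) - Re (2 * cnj a * I z)" by simp
        qed
        also have "\<dots> = (1 + (norm a)\<^sup>2) - Re (2 * cnj a * a)"
        proof -
          have "bounded_linear (\<lambda>w. Re (2 * cnj a * w))"
            by (intro bounded_linear_compose[OF bounded_linear_Re] bounded_linear_mult_right)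
          from circle_mean_linear[OF r cont(1) this]
          have "circle_mean r (\<lambda>z. Re (2 * cnj a * I z)) = Re (2 * cnj a * a)"
            by (simp only: circle_mean_holomorphic[OF r holI] a_def)
          then show ?thesis
            by (subst circle_mean_diff[OF r]) (auto intro!: continuous_intros simp: r)
        qed
        also have "\<dots> = d"
          unfolding d_def cmod_power2 by (simp add: power2_eq_square algebra_simps)
        finally show "circle_mean r (\<lambda>z. (norm (u z))\<^sup>2) \<le> d" .
      qed (use p q in auto)
      also have "1 / q = 1 - 1 / p" using q by simp
      finally show ?thesis by simp
    qed
    finally show ?thesis by (simp add: \<epsilon>_def)
  qed
  have "(\<lambda>k. D (radii k)) \<longlonglongrightarrow> 1 - 1\<^sup>2"
    unfolding D_def by (rule inner_mean_tendsto[OF I]) (intro continuous_intros)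
  then have "(\<lambda>k. M / p + d * (1 - 1 / p) + \<epsilon> + C * D (radii k))
      \<longlonglongrightarrow> M / p + d * (1 - 1 / p) + \<epsilon> + C * (1 - 1\<^sup>2)"
    by (intro tendsto_intros)
  then have "d \<le> M / p + d * (1 - 1 / p) + \<epsilon> + C * (1 - 1\<^sup>2)"
    by (rule LIMSEQ_le_const) (use main radii in blast)
  then show ?thesis by (simp add: d_def \<epsilon>_def a_def)
qed

lemma poly_bounded_ball:
  fixes s :: "complex poly"
  obtains K where "K \<ge> 0" "\<And>z. z \<in> ball 0 1 \<Longrightarrow> norm (poly s z) \<le> K"
proof -
  have "bounded (poly s ` cball 0 1)"
    by (intro compact_imp_bounded compact_continuous_image continuous_intros) auto
  then obtain K where K: "\<And>z. z \<in> cball 0 1 \<Longrightarrow> norm (poly s z) \<le> K"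
    unfolding bounded_iff by blast
  show ?thesis
  proof (rule that)
    show "0 \<le> K" using K[of 0] norm_ge_zero[of "poly s 0"] by (simp del: norm_ge_zero)
  qed (use K in auto)
qed

text \<open>The truncation argument. The product of the polynomial and the outer function \<open>F\<close> need not be bounded,
  and that \<open>F\<close> belongs to the Hardy space is not evident without boundary values of Poisson integrals.
  Instead, with \<open>h\<close> the logarithm of the boundary modulus of \<open>F\<close>, multiply by the outer function \<open>e N\<close>
  with boundary modulus \<open>exp (- max 0 (h - N))\<close>. It is bounded by 1, hence only decreases
  \<open>\<bar>1 - I s F\<bar>\<close>; it makes \<open>F * e N\<close> bounded by \<open>exp N\<close>; and \<open>e N 0\<close> tends to 1. The limit of the core estimate
  reads \<open>d \<le> M / p + d (1 - 1 / p)\<close>, that is \<open>d \<le> M\<close>. Outerness of \<open>F\<close> is essential: if \<open>F\<close> were the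
  reciprocal of a singular inner function \<open>I\<close> and \<open>s = 1\<close>, then \<open>1 - I s F\<close> would vanish.\<close>
lemma inner_outer_lower_bound:
  fixes p M :: real and s :: "complex poly"
  assumes p: "1 < p" and I: "inner_function I" and F: "outer_function F"
    and M: "\<And>r. 0 < r \<Longrightarrow> r < 1 \<Longrightarrow> hardy_mean p (\<lambda>z. 1 - I z * poly s z * F z) r \<le> M"
  shows "1 - (norm (I 0))\<^sup>2 \<le> M"
proof -
  have Mg: "circle_mean r (\<lambda>z. norm (1 - I z * poly s z * F z) powr p) \<le> M" if "0 < r" "r < 1" for r
    using M[OF that] by (simp add: hardy_mean_eq_circle_mean)
  obtain c h where c: "norm c = 1" and h: "h absolutely_integrable_on {0..2*pi}"
    and F_eq: "\<And>z. z \<in> ball 0 1 \<Longrightarrow> F z = c * exp (herglotz h z)"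
    using F unfolding outer_function_def herglotz_def by blast
  have holI: "I holomorphic_on ball 0 1" by (rule inner_holomorphic[OF I])
  have "(\<lambda>z. c * exp (herglotz h z)) holomorphic_on ball 0 1"
    by (intro holomorphic_intros herglotz_holomorphic h)
  then have holF: "F holomorphic_on ball 0 1"
    by (rule holomorphic_transform) (simp add: F_eq)
  have I0: "norm (I 0) \<le> 1" using inner_norm_le_1[OF I, of 0] by simp
  show ?thesis
  proof (cases "norm (I 0) = 1")
    case True
    have contg: "continuous_on (ball 0 1) (\<lambda>z. norm (1 - I z * poly s z * F z) powr p)"
      by (intro continuous_on_norm_powr continuous_intros holomorphic_on_imp_continuous_on holI holF)
         (use p in auto)
    have "0 = circle_mean (1/2) (\<lambda>z. 0 :: real)" by simp
    also have "\<dots> \<le> circle_mean (1/2) (\<lambda>z. norm (1 - I z * poly s z * F z) powr p)"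
      by (intro circle_mean_mono contg continuous_intros) auto
    also have "\<dots> \<le> M" by (rule Mg) auto
    finally show ?thesis using True by simp
  next
    case False
    with I0 have I0': "norm (I 0) < 1" by simp
    define d where "d = 1 - (norm (I 0))\<^sup>2"
    define e where "e N z = exp (- herglotz (\<lambda>t. max 0 (h t - real N)) z)" for N z
    obtain K where K: "K \<ge> 0" "\<And>z. z \<in> ball 0 1 \<Longrightarrow> norm (poly s z) \<le> K"
      using poly_bounded_ball by blast
    have bound: "d \<le> M / p + d * (1 - 1 / p) + (norm (1 - e N 0) + sqrt (2 - 2 * Re (e N 0)))" for N
    proof -
      let ?x = "\<lambda>t. max 0 (h t - real N)"
      have x: "?x absolutely_integrable_on {0..2*pi}"
        by (intro absolutely_integrable_max_1 set_integral_diff(1) h absolutely_integrable_on_const) auto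
      have hx: "(\<lambda>t. h t - ?x t) absolutely_integrable_on {0..2*pi}"
        by (intro set_integral_diff(1) h x)
      define H where "H z = poly s z * (c * exp (herglotz (\<lambda>t. h t - ?x t) z))" for z
      have eF: "e N z * F z = c * exp (herglotz (\<lambda>t. h t - ?x t) z)" if "z \<in> ball 0 1" for z
        by (simp add: e_def F_eq[OF that] herglotz_diff[OF h x that] exp_diff exp_minus divide_inverse)
      have e1: "norm (e N z) \<le> 1" if "z \<in> ball 0 1" for z
        using Re_herglotz_nonneg[OF x that] by (simp add: e_def)
      show ?thesis unfolding d_def
      proof (rule inner_truncated_estimate[OF p I I0' _ e1 _ _ _ _ Mg])
        show "e N holomorphic_on ball 0 1"
          unfolding e_def[abs_def] by (intro holomorphic_intros herglotz_holomorphic x)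
        show "H holomorphic_on ball 0 1"
          unfolding H_def[abs_def] by (intro holomorphic_intros herglotz_holomorphic hx)
        show "norm (H z) \<le> K * exp (real N)" if z: "z \<in> ball 0 1" for z
        proof -
          have "Re (herglotz (\<lambda>t. h t - ?x t) z) \<le> real N"
            by (intro Re_herglotz_le hx z) auto
          then show ?thesis
            using K(2)[OF z] K(1) by (auto simp: H_def norm_mult c intro!: mult_mono)
        qed
        show "continuous_on (ball 0 1) (\<lambda>z. 1 - I z * poly s z * F z)"
          by (intro continuous_intros holomorphic_on_imp_continuous_on holI holF)
        show "norm (e N z - I z * H z) \<le> norm (1 - I z * poly s z * F z)" if z: "z \<in> ball 0 1" for z
        proof -
          have "e N z - I z * H z = e N z * (1 - I z * poly s z * F z)"
            unfolding H_def eF[OF z, symmetric] by (simp add: algebra_simps)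
          then show ?thesis
            using mult_right_mono[OF e1[OF z], of "norm (1 - I z * poly s z * F z)"]
            by (simp add: norm_mult)
        qed
      qed
    qed
    have e0: "(\<lambda>N. e N 0) \<longlonglongrightarrow> exp (- 0)"
      unfolding e_def by (intro tendsto_intros herglotz_excess_tendsto h)
    have "(\<lambda>N. M / p + d * (1 - 1 / p) + (norm (1 - e N 0) + sqrt (2 - 2 * Re (e N 0))))
        \<longlonglongrightarrow> M / p + d * (1 - 1 / p) + (norm (1 - exp (- 0 :: complex)) + sqrt (2 - 2 * Re (exp (- 0))))"
      by (intro tendsto_intros e0)
    then have "d \<le> M / p + d * (1 - 1 / p) + (norm (1 - exp (- 0 :: complex)) + sqrt (2 - 2 * Re (exp (- 0))))"
      by (rule LIMSEQ_le_const) (use bound in blast)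
    then have "d \<le> M"
      using p by (simp add: field_simps)
    then show ?thesis by (simp add: d_def)
  qed
qed

section \<open>Means of powers and the best constant approximant\<close>

lemma holomorphic_continuous_norm_powr:
  assumes "f holomorphic_on ball 0 1" "0 < p"
  shows "continuous_on (ball 0 1) (\<lambda>z. norm (f z) powr p)"
  by (intro continuous_on_norm_powr holomorphic_on_imp_continuous_on assms)

lemma hardy_mean_nonneg:
  assumes "f holomorphic_on ball 0 1" "0 < p" "0 < r" "r < 1"
  shows "0 \<le> hardy_mean p f r"
proof -
  have "0 = circle_mean r (\<lambda>z. 0 :: real)" using assms by simp
  also have "\<dots> \<le> hardy_mean p f r"
    unfolding hardy_mean_eq_circle_mean
    by (intro circle_mean_mono holomorphic_continuous_norm_powr continuous_intros assms) auto
  finally show ?thesis .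
qed

text \<open>Jensen's inequality for the concave power \<open>p / 2\<close>, in the form of a tangent line: the weighted
  arithmetic-geometric mean inequality is averaged over the circle.\<close>
lemma hardy_mean_le_power:
  assumes f: "f holomorphic_on ball 0 1" and p: "0 < p" "p < 2" and r: "0 < r" "r < 1"
    and T: "hardy_mean 2 f r \<le> T" 
  shows "hardy_mean p f r \<le> T powr (p / 2)"
proof -
  have pos: "hardy_mean p f r \<le> U powr (p / 2)" if U: "0 < U" "T \<le> U" for U
  proof -
    have c2: "continuous_on (ball 0 1) (\<lambda>z. norm (f z) powr 2)"
      by (rule holomorphic_continuous_norm_powr[OF f]) simp
    have "hardy_mean p f r * U powr (1 - p / 2)
        = circle_mean r (\<lambda>z. norm (f z) powr p * U powr (1 - p / 2))"
      unfolding hardy_mean_eq_circle_mean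
      by (rule circle_mean_mult[OF r, symmetric])
    also have "\<dots> \<le> circle_mean r (\<lambda>z. (p / 2) * norm (f z) powr 2 + (1 - p / 2) * U)"
    proof (rule circle_mean_mono[OF r])
      show "continuous_on (ball 0 1) (\<lambda>z. norm (f z) powr p * U powr (1 - p / 2))"
        by (rule continuous_on_mult[OF holomorphic_continuous_norm_powr[OF f p(1)] continuous_on_const])
      show "continuous_on (ball 0 1) (\<lambda>z. (p / 2) * norm (f z) powr 2 + (1 - p / 2) * U)"
        by (rule continuous_on_add[OF continuous_on_mult[OF continuous_on_const c2] continuous_on_const])
      fix z
      have "(norm (f z) powr 2) powr (p / 2) * U powr (1 - p / 2)
          \<le> (p / 2) * norm (f z) powr 2 + (1 - p / 2) * U"
      proof (cases "f z = 0")
        case False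
        then show ?thesis by (intro Youngs_inequality_0) (use p U in auto)
      qed (use p U in auto)
      then show "norm (f z) powr p * U powr (1 - p / 2)
          \<le> (p / 2) * norm (f z) powr 2 + (1 - p / 2) * U"
        by (simp only: powr_powr) simp
    qed
    also have "\<dots> = (p / 2) * hardy_mean 2 f r + (1 - p / 2) * U"
      unfolding hardy_mean_eq_circle_mean
      by (simp only: circle_mean_add[OF r] circle_mean_const[OF r] circle_mean_mult[OF r] c2
          continuous_on_mult_left continuous_on_const)
    also have "\<dots> \<le> (p / 2) * U + (1 - p / 2) * U"
      using T U p by (intro add_right_mono mult_left_mono) auto
    also have "\<dots> = U powr (p / 2) * U powr (1 - p / 2)"
      using U by (simp add: powr_add[symmetric] algebra_simps)
    finally show ?thesis using U by simp
  qed
  have "0 \<le> hardy_mean 2 f r" by (rule hardy_mean_nonneg[OF f _ r]) simp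
  then consider "0 < T" | "T = 0" using T by linarith
  then show ?thesis
  proof cases
    case 2
    \<comment> \<open>there is no tangent line at 0, so the bound is taken in the limit \<open>U \<rightarrow> 0\<close>\<close>
    have "hardy_mean p f r \<le> 0 + \<epsilon>" if "0 < \<epsilon>" for \<epsilon>
      using pos[of "\<epsilon> powr (2 / p)"] that p 2 by (simp add: powr_powr)
    from field_le_epsilon[OF this] show ?thesis using 2 p by simp
  qed (use pos in auto)
qed

lemma norm_at_0_le_hardy_mean:
  assumes f: "f holomorphic_on ball 0 1" and r: "0 < r" "r < 1"
  shows "(norm (f 0))\<^sup>2 \<le> hardy_mean 2 f r"
proof -
  note cont = holomorphic_on_imp_continuous_on[OF f]
  have "norm (f 0) \<le> circle_mean r (\<lambda>z. norm (f z))"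
    using norm_circle_mean_le[OF r cont continuous_on_norm[OF cont]] circle_mean_holomorphic[OF r f] by simp
  then have "(norm (f 0))\<^sup>2 \<le> (circle_mean r (\<lambda>z. norm (f z)))\<^sup>2"
    by (intro power_mono) auto
  also have "\<dots> \<le> hardy_mean 2 f r"
    using circle_mean_power2_le[OF r continuous_on_norm[OF cont]]
    by (simp add: hardy_mean_eq_circle_mean)
  finally show ?thesis .
qed

lemma hardy_space_one_minus_poly:
  fixes s :: "complex poly"
  assumes f: "f \<in> hardy_space p" and p: "0 < p"
  shows "(\<lambda>z. 1 - poly s z * f z) \<in> hardy_space p"
proof -
  have holf: "f holomorphic_on ball 0 1" and bdd: "bdd_above (hardy_mean p f ` {0<..<1})"
    using f by (auto simp: hardy_space_def)
  obtain B where B: "\<And>r. r \<in> {0<..<1} \<Longrightarrow> hardy_mean p f r \<le> B"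
    using bdd unfolding bdd_above_def by blast
  obtain K where K: "K \<ge> 0" "\<And>z. z \<in> ball 0 1 \<Longrightarrow> norm (poly s z) \<le> K"
    using poly_bounded_ball by blast
  have hol: "(\<lambda>z. 1 - poly s z * f z) holomorphic_on ball 0 1"
    by (intro holomorphic_intros holf)
  have "hardy_mean p (\<lambda>z. 1 - poly s z * f z) r \<le> 2 powr p + (2 * K) powr p * B"
    if r: "r \<in> {0<..<1}" for r
  proof -
    have r': "0 < r" "r < 1" using r by auto
    have "hardy_mean p (\<lambda>z. 1 - poly s z * f z) r
        \<le> circle_mean r (\<lambda>z. 2 powr p + (2 * K) powr p * norm (f z) powr p)"
      unfolding hardy_mean_eq_circle_mean
    proof (intro circle_mean_mono r' holomorphic_continuous_norm_powr hol holf p continuous_intros)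
      fix z :: complex assume z: "z \<in> ball 0 1"
      have "norm (1 - poly s z * f z) \<le> 1 + norm (poly s z) * norm (f z)"
        using norm_triangle_ineq4[of 1 "poly s z * f z"] by (simp add: norm_mult)
      also have "\<dots> \<le> 1 + K * norm (f z)"
        using K(2)[OF z] by (intro add_left_mono mult_right_mono) auto
      also have "\<dots> \<le> 2 * max 1 (K * norm (f z))" by simp
      finally have "norm (1 - poly s z * f z) powr p \<le> (2 * max 1 (K * norm (f z))) powr p"
        by (intro powr_mono2) (use p in auto)
      also have "\<dots> \<le> 2 powr p + (2 * (K * norm (f z))) powr p"
        by (simp add: max_def)
      also have "\<dots> = 2 powr p + (2 * K) powr p * norm (f z) powr p"
        using K(1) by (simp add: powr_mult)
      finally show "norm (1 - poly s z * f z) powr p \<le> 2 powr p + (2 * K) powr p * norm (f z) powr p" .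
    qed
    also have "\<dots> = 2 powr p + (2 * K) powr p * hardy_mean p f r"
      unfolding hardy_mean_eq_circle_mean
      by (simp only: circle_mean_add[OF r'] circle_mean_const[OF r'] circle_mean_mult[OF r']
          holomorphic_continuous_norm_powr[OF holf p] continuous_on_mult_left continuous_on_const)
    also have "\<dots> \<le> 2 powr p + (2 * K) powr p * B"
      using B[OF r] by (intro add_left_mono mult_left_mono) auto
    finally show ?thesis .
  qed
  then have "bdd_above (hardy_mean p (\<lambda>z. 1 - poly s z * f z) ` {0<..<1})"
    by (rule bdd_aboveI2)
  then show ?thesis
    unfolding hardy_space_def using hol by blast
qed

lemma hardy_space_mean_le_Sup:
  assumes "f \<in> hardy_space p" "0 < r" "r < 1"
  shows "hardy_mean p f r \<le> (SUP r\<in>{0<..<1}. hardy_mean p f r)"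
  by (rule cSUP_upper) (use assms in \<open>auto simp: hardy_space_def\<close>)

lemma Sup_hardy_mean_le_if_hardy_norm_le:
  assumes f: "f \<in> hardy_space p" and g: "g \<in> hardy_space p" and p: "0 < p"
    and le: "hardy_norm p f \<le> hardy_norm p g"
  shows "(SUP r\<in>{0<..<1}. hardy_mean p f r) \<le> (SUP r\<in>{0<..<1}. hardy_mean p g r)"
proof (rule ccontr)
  have "0 \<le> hardy_mean p g (1/2)"
    by (rule hardy_mean_nonneg) (use g p in \<open>auto simp: hardy_space_def\<close>)
  also have "\<dots> \<le> (SUP r\<in>{0<..<1}. hardy_mean p g r)"
    by (rule hardy_space_mean_le_Sup[OF g]) auto
  finally have "0 \<le> (SUP r\<in>{0<..<1}. hardy_mean p g r)" .
  moreover assume "\<not> ?thesis"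
  ultimately show False
    using le p powr_less_mono2[of "1 / p" "SUP r\<in>{0<..<1}. hardy_mean p g r"
        "SUP r\<in>{0<..<1}. hardy_mean p f r"]
    by (auto simp: hardy_norm_def not_le)
qed

lemma hardy2_quotient_le_1:
  assumes f: "f holomorphic_on ball 0 1"
  shows "hardy2_quotient f \<le> 1"
proof -
  have "(norm (f 0))\<^sup>2 \<le> (hardy_norm 2 f)\<^sup>2" if "f \<in> hardy_space 2"
  proof -
    let ?S = "SUP r\<in>{0<..<1}. hardy_mean 2 f r"
    have "(norm (f 0))\<^sup>2 \<le> hardy_mean 2 f (1/2)"
      by (rule norm_at_0_le_hardy_mean[OF f]) auto
    also have "\<dots> \<le> ?S" by (rule hardy_space_mean_le_Sup[OF that]) auto
    finally have S: "(norm (f 0))\<^sup>2 \<le> ?S" .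
    then have "0 \<le> ?S" by (rule order_trans[OF zero_le_power2])
    with S show ?thesis by (simp add: hardy_norm_def powr_half_sqrt)
  qed
  then show ?thesis
    by (auto simp: hardy2_quotient_def divide_le_eq_1)
qed

text \<open>The constant \<open>c = cnj (f 0) / S\<close> with \<open>S\<close> the squared quadratic norm of \<open>f\<close> is the minimizer of
  \<open>1 - 2 Re (c f(0)) + \<bar>c\<bar>\<^sup>2 S\<close>, the squared quadratic norm of \<open>1 - c f\<close>; the minimum is 1 minus the quotient.
  Where the quotient is 0 by convention, \<open>c = 0\<close> serves.\<close>
lemma hardy_mean_constant_approximant:
  assumes f: "f holomorphic_on ball 0 1" and p: "0 < p" "p < 2"
  obtains c where "\<And>r. 0 < r \<Longrightarrow> r < 1 \<Longrightarrow>
    hardy_mean p (\<lambda>z. 1 - c * f z) r \<le> (1 - hardy2_quotient f) powr (p / 2)"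
proof -
  define S where "S = (hardy_norm 2 f)\<^sup>2"
  show ?thesis
  proof (cases "f \<in> hardy_space 2 \<and> S \<noteq> 0")
    case False
    then have "hardy2_quotient f = 0" by (auto simp: hardy2_quotient_def S_def)
    then show ?thesis
      by (intro that[of 0]) (simp add: hardy_mean_eq_circle_mean)
  next
    case True
    then have S: "0 < S" by (simp add: S_def zero_less_power2)
    have Q: "hardy2_quotient f = (norm (f 0))\<^sup>2 / S"
      using True by (simp add: hardy2_quotient_def S_def)
    have S_eq: "(SUP r\<in>{0<..<1}. hardy_mean 2 f r) = S"
    proof -
      have "0 \<le> hardy_mean 2 f (1/2)" by (rule hardy_mean_nonneg[OF f]) auto
      also have "\<dots> \<le> (SUP r\<in>{0<..<1}. hardy_mean 2 f r)"
        by (rule hardy_space_mean_le_Sup) (use True in auto)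
      finally show ?thesis by (simp add: S_def hardy_norm_def powr_half_sqrt)
    qed
    define c where "c = cnj (f 0) / of_real S"
    have mean2: "hardy_mean 2 (\<lambda>z. 1 - c * f z) r \<le> 1 - hardy2_quotient f" if r: "0 < r" "r < 1" for r
    proof -
      have fr: "hardy_mean 2 f r \<le> S"
        using hardy_space_mean_le_Sup[OF _ r, of f 2] True S_eq by simp
      note cont = holomorphic_on_imp_continuous_on[OF f]
      have c2: "continuous_on (ball 0 1) (\<lambda>z. (norm (f z))\<^sup>2)"
        by (intro continuous_intros cont)
      have lin: "bounded_linear (\<lambda>w. Re (2 * c * w))"
        by (intro bounded_linear_compose[OF bounded_linear_Re] bounded_linear_mult_right)
      have c1: "continuous_on (ball 0 1) (\<lambda>z. Re (2 * c * f z))"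
        by (intro continuous_intros cont)
      have hardy2_eq: "hardy_mean 2 f r = circle_mean r (\<lambda>z. (norm (f z))\<^sup>2)"
        by (simp add: hardy_mean_eq_circle_mean)
      have "(norm (1 - c * f z))\<^sup>2 = 1 - Re (2 * c * f z) + (norm c)\<^sup>2 * (norm (f z))\<^sup>2" for z
        unfolding cmod_power2 by (simp add: power2_eq_square algebra_simps)
      then have "hardy_mean 2 (\<lambda>z. 1 - c * f z) r
          = circle_mean r (\<lambda>z. 1 - Re (2 * c * f z) + (norm c)\<^sup>2 * (norm (f z))\<^sup>2)"
        by (simp add: hardy_mean_eq_circle_mean)
      also have "\<dots> = 1 - Re (2 * c * f 0) + (norm c)\<^sup>2 * hardy_mean 2 f r"
        by (simp only: circle_mean_add[OF r] circle_mean_diff[OF r] circle_mean_mult[OF r]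
            circle_mean_linear[OF r cont lin] circle_mean_const[OF r] circle_mean_holomorphic[OF r f]
            c1 c2 continuous_on_diff continuous_on_mult_left continuous_on_const hardy2_eq)
      also have "\<dots> \<le> 1 - Re (2 * c * f 0) + (norm c)\<^sup>2 * S"
        using fr by (intro add_left_mono mult_left_mono) auto
      also have "\<dots> = 1 - hardy2_quotient f"
      proof -
        have "2 * c * f 0 = of_real (2 * (norm (f 0))\<^sup>2 / S)"
          by (simp add: c_def complex_norm_square mult.commute del: of_real_power)
        then have "Re (2 * c * f 0) = 2 * (norm (f 0))\<^sup>2 / S"
          by (simp only: Re_complex_of_real)
        moreover have "(norm c)\<^sup>2 * S = (norm (f 0))\<^sup>2 / S"
          using S by (simp add: c_def norm_divide power_divide power2_eq_square)
        ultimately show ?thesis by (simp add: Q)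
      qed
      finally show ?thesis .
    qed
    show ?thesis
    proof (rule that)
      show "hardy_mean p (\<lambda>z. 1 - c * f z) r \<le> (1 - hardy2_quotient f) powr (p / 2)"
        if r: "0 < r" "r < 1" for r
        by (intro hardy_mean_le_power p r mean2) (intro holomorphic_intros f)
    qed
  qed
qed

section \<open>Roots of optimal approximants\<close>

lemma norm_blaschke_product_at_0:
  "norm (\<Prod>w\<in>#M. (0 - w) / (1 - cnj w * 0)) = norm (prod_mset M)"
  by (induction M) (auto simp: norm_mult)

text \<open>Both bounds for the \<open>p\<close>-th power of the norm of \<open>1 - q f\<close> meet here. The lower one is applied to
  the inner function \<open>I = J B\<close>, where \<open>B\<close> is the Blaschke product of the roots of \<open>q\<close> in the disk; the upper one
  holds because constants compete in the infimum.\<close>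
lemma roots_in_disk_lower_bound:
  fixes p :: real
  assumes p: "1 < p" "p < 2" and f: "f \<in> hardy_space p" and J: "inner_part f J" and J0: "J 0 \<noteq> 0"
    and q: "optimal_poly_approx n p f q"
  shows "norm (prod_mset (roots_in_disk q))
    \<ge> sqrt (1 - (1 - hardy2_quotient f) powr (p / 2)) / norm (J 0)"
proof -
  have p0: "0 < p" using p by simp
  have holf: "f holomorphic_on ball 0 1" using f by (simp add: hardy_space_def)
  obtain F where innerJ: "inner_function J" and F: "outer_function F"
    and f_eq: "\<And>z. z \<in> ball 0 1 \<Longrightarrow> f z = J z * F z"
    using J unfolding inner_part_def by blast
  define B where "B z = (\<Prod>w\<in>#roots_in_disk q. (z - w) / (1 - cnj w * z))" for z
  obtain s where s: "\<And>z. z \<in> ball 0 1 \<Longrightarrow> poly q z = B z * poly s z"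
    unfolding B_def using poly_factor_blaschke[of q] by blast
  have innerB: "inner_function B"
    unfolding B_def[abs_def] by (rule blaschke_product_inner) (auto simp: roots_in_disk_def)
  define I where "I z = J z * B z" for z
  have innerI: "inner_function I"
    unfolding I_def[abs_def] by (rule inner_mult[OF innerJ innerB])
  have H: "(\<lambda>z. 1 - poly s z * f z) \<in> hardy_space p" for s
    by (rule hardy_space_one_minus_poly[OF f p0])
  let ?S = "\<lambda>g. SUP r\<in>{0<..<1}. hardy_mean p g r"
  have lower: "1 - (norm (I 0))\<^sup>2 \<le> ?S (\<lambda>z. 1 - poly q z * f z)"
  proof (rule inner_outer_lower_bound[OF p(1) innerI F])
    fix r :: real assume r: "0 < r" "r < 1"
    have "hardy_mean p (\<lambda>z. 1 - I z * poly s z * F z) r = hardy_mean p (\<lambda>z. 1 - poly q z * f z) r"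
      unfolding hardy_mean_eq_circle_mean
      by (rule circle_mean_cong[OF r]) (simp add: s f_eq I_def mult_ac)
    also have "\<dots> \<le> ?S (\<lambda>z. 1 - poly q z * f z)"
      by (rule hardy_space_mean_le_Sup[OF H r])
    finally show "hardy_mean p (\<lambda>z. 1 - I z * poly s z * F z) r \<le> ?S (\<lambda>z. 1 - poly q z * f z)" .
  qed
  obtain c where c: "\<And>r. 0 < r \<Longrightarrow> r < 1 \<Longrightarrow>
      hardy_mean p (\<lambda>z. 1 - c * f z) r \<le> (1 - hardy2_quotient f) powr (p / 2)"
    using hardy_mean_constant_approximant[OF holf p0 p(2)] by blast
  have "hardy_norm p (\<lambda>z. 1 - poly q z * f z)
      = (INF s\<in>{s :: complex poly. degree s \<le> n}. hardy_norm p (\<lambda>z. 1 - poly s z * f z))"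
    using q by (simp add: optimal_poly_approx_def)
  also have "\<dots> \<le> hardy_norm p (\<lambda>z. 1 - poly [:c:] z * f z)"
    by (rule cINF_lower) (auto intro!: bdd_belowI2[of _ 0] simp: hardy_norm_def)
  finally have "?S (\<lambda>z. 1 - poly q z * f z) \<le> ?S (\<lambda>z. 1 - poly [:c:] z * f z)"
    by (rule Sup_hardy_mean_le_if_hardy_norm_le[OF H H p0])
  also have "\<dots> \<le> (1 - hardy2_quotient f) powr (p / 2)"
    by (rule cSUP_least) (use c in auto)
  finally have "1 - (1 - hardy2_quotient f) powr (p / 2) \<le> (norm (I 0))\<^sup>2"
    using lower by simp
  then have "sqrt (1 - (1 - hardy2_quotient f) powr (p / 2)) \<le> norm (I 0)"
    by (rule real_le_lsqrt[rotated 1]) auto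
  also have "norm (I 0) = norm (prod_mset (roots_in_disk q)) * norm (J 0)"
    using norm_blaschke_product_at_0[of "roots_in_disk q"] by (simp add: I_def B_def norm_mult)
  finally show ?thesis using J0 by (simp add: pos_divide_le_eq)
qed

lemma inner_function_hardy:
  assumes J: "inner_function J" and p: "0 < p"
  shows "J \<in> hardy_space p" "(SUP r\<in>{0<..<1}. hardy_mean p J r) \<le> 1"
proof -
  have hol: "J holomorphic_on ball 0 1" by (rule inner_holomorphic[OF J])
  have le: "hardy_mean p J r \<le> 1" if r: "r \<in> {0<..<1}" for r
  proof -
    have r': "0 < r" "r < 1" using r by auto
    have "hardy_mean p J r \<le> circle_mean r (\<lambda>z. 1)"
      unfolding hardy_mean_eq_circle_mean
      by (intro circle_mean_mono r' holomorphic_continuous_norm_powr hol p continuous_intros)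
         (use inner_norm_le_1[OF J] p in \<open>auto simp: powr_le1\<close>)
    then show ?thesis using r' by simp
  qed
  then have "bdd_above (hardy_mean p J ` {0<..<1})"
    by (rule bdd_aboveI2)
  then show "J \<in> hardy_space p"
    unfolding hardy_space_def using hol by blast
  show "(SUP r\<in>{0<..<1}. hardy_mean p J r) \<le> 1"
    by (rule cSUP_least) (use le in auto)
qed

lemma inner_part_self:
  assumes "inner_function J"
  shows "inner_part J J"
proof -
  have "outer_function (\<lambda>z. 1)"
    unfolding outer_function_def by (intro exI[of _ 1] exI[of _ "\<lambda>t. 0"]) simp
  with assms show ?thesis
    unfolding inner_part_def by (intro conjI exI[of _ "\<lambda>z. 1"]) auto
qed

text \<open>The quadratic norm of an inner function is at most 1 because \<open>\<bar>J\<bar> \<le> 1\<close>.\<close>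
lemma hardy2_quotient_inner_ge:
  assumes J: "inner_function J" and J0: "J 0 \<noteq> 0"
  shows "(norm (J 0))\<^sup>2 \<le> hardy2_quotient J"
proof -
  note H2 = inner_function_hardy[OF J, of 2, simplified]
  let ?S = "SUP r\<in>{0<..<1}. hardy_mean 2 J r"
  have "(norm (J 0))\<^sup>2 \<le> hardy_mean 2 J (1/2)"
    by (rule norm_at_0_le_hardy_mean[OF inner_holomorphic[OF J]]) auto
  also have "\<dots> \<le> ?S" by (rule hardy_space_mean_le_Sup[OF H2(1)]) auto
  finally have "(norm (J 0))\<^sup>2 \<le> ?S" .
  then have S: "0 < ?S" using J0 by (smt (verit) norm_eq_zero zero_less_power2)
  then have "hardy2_quotient J = (norm (J 0))\<^sup>2 / ?S"
    using H2(1) by (simp add: hardy2_quotient_def hardy_norm_def powr_half_sqrt)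
  then show ?thesis
    using S inner_function_hardy(2)[OF J, of 2] by (simp add: pos_le_divide_eq mult_left_le)
qed

theorem proposition4p9:
  fixes p :: real and n :: nat
  assumes "1 < p" and "p < 2"
  shows
    "(\<forall>f J q. f \<in> hardy_space p \<longrightarrow> inner_part f J \<longrightarrow> J 0 \<noteq> 0 \<longrightarrow> optimal_poly_approx n p f q \<longrightarrow>
        norm (prod_mset (roots_in_disk q))
          \<ge> sqrt (1 - (1 - hardy2_quotient f) powr (p / 2)) / norm (J 0)) \<and>
     (\<forall>J q. inner_function J \<longrightarrow> J 0 \<noteq> 0 \<longrightarrow> optimal_poly_approx n p J q \<longrightarrow>
        norm (prod_mset (roots_in_disk q))
          \<ge> sqrt (1 - (1 - (norm (J 0))\<^sup>2) powr (p / 2)) / norm (J 0))"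
proof (intro conjI allI impI)
  fix f J q
  assume "f \<in> hardy_space p" "inner_part f J" "J 0 \<noteq> 0" "optimal_poly_approx n p f q"
  then show "norm (prod_mset (roots_in_disk q))
      \<ge> sqrt (1 - (1 - hardy2_quotient f) powr (p / 2)) / norm (J 0)"
    by (rule roots_in_disk_lower_bound[OF assms])
next
  fix J q
  assume J: "inner_function J" "J 0 \<noteq> 0" and q: "optimal_poly_approx n p J q"
  have "(1 - hardy2_quotient J) powr (p / 2) \<le> (1 - (norm (J 0))\<^sup>2) powr (p / 2)"
    using hardy2_quotient_inner_ge[OF J] hardy2_quotient_le_1[OF inner_holomorphic[OF J(1)]] assms
    by (intro powr_mono2) auto
  then have "sqrt (1 - (1 - (norm (J 0))\<^sup>2) powr (p / 2)) / norm (J 0)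
      \<le> sqrt (1 - (1 - hardy2_quotient J) powr (p / 2)) / norm (J 0)"
    by (intro divide_right_mono real_sqrt_le_mono) auto
  also have "\<dots> \<le> norm (prod_mset (roots_in_disk q))"
    by (rule roots_in_disk_lower_bound[OF assms _ inner_part_self[OF J(1)] J(2) q])
       (use inner_function_hardy(1)[OF J(1)] assms in auto)
  finally show "norm (prod_mset (roots_in_disk q))
      \<ge> sqrt (1 - (1 - (norm (J 0))\<^sup>2) powr (p / 2)) / norm (J 0)" .
qed

end
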